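(* Let $x=\{x_k\}_{k=1}^{\infty}$ be a sequence of nonzero complex numbers such that $\sum_{k=1}^{\infty}|x_kx_{k+1}|<\infty$. Then the zeros of the entire even function $f(w)=\mathfrak{F}(wx)$, $w\in\mathbb{C}$, can be arranged into sequences $$\{\zeta_k\}_{k=1}^{N(f)}\cup\{-\zeta_k\}_{k=1}^{N(f)},$$ with each zero being repeated according to its multiplicity, where $N(f)$ is a non-negative integer or $\infty$, and for all $w\in\mathbb{C}$, $$f(w)=\prod_{k=1}^{N(f)}\left(1-\frac{w^{2}}{\zeta_k^{2}}\right).$$
   Context: The function $\mathfrak{F}$ is defined on $D=\{\{x_k\}_{k=1}^\infty\subset\mathbb{C};\ \sum_{k}|x_kx_{k+1}|<\infty\}$ by $$\mathfrak{F}(x)=1+\sum_{m=1}^{\infty}(-1)^m\sum_{k_1=1}^{\infty}\,\sum_{k_2=k_1+2}^{\infty}\cdots\sum_{k_m=k_{m-1}+2}^{\infty}x_{k_1}x_{k_1+1}x_{k_2}x_{k_2+1}\cdots x_{k_m}x_{k_m+1}.$$ For $w\in\mathbb{C}$, $wx$ denotes the sequence $\{wx_k\}_{k=1}^\infty$. Note that $f(0)=1$. An empty product equals $1$. *)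

theory Defs
  imports "HOL-Complex_Analysis.Complex_Analysis"
begin

text \<open>
  A sequence indexed by the positive integers is a function on \<^typ>\<open>nat\<close> whose value at
  0 is never used.
\<close>

definition frakF_domain :: "(nat \<Rightarrow> complex) set" where
  "frakF_domain = {x. summable (\<lambda>k. norm (x (k + 1) * x (k + 2)))}"

text \<open>
  \<open>gap_sum x m l\<close> is the \<open>m\<close>-fold iterated series of the products
  \<open>x k1 * x (k1 + 1) * \<dots> * x km * x (km + 1)\<close>, where \<open>k1\<close> starts at \<open>l\<close> and
  each further index starts at the preceding one plus 2. The factor that depends only on
  the outermost index is written in front of the inner series.
\<close>

primrec gap_sum :: "(nat \<Rightarrow> complex) \<Rightarrow> nat \<Rightarrow> nat \<Rightarrow> complex" where
  "gap_sum x 0 l = 1"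
| "gap_sum x (Suc m) l =
     (\<Sum>j. x (l + j) * x (l + j + 1) * gap_sum x m (l + j + 2))"

definition frakF :: "(nat \<Rightarrow> complex) \<Rightarrow> complex" where
  "frakF x = 1 + (\<Sum>m. (- 1) ^ (m + 1) * gap_sum x (m + 1) 1)"

text \<open>
  The family \<open>(a i)\<close>, \<open>i \<in> I\<close>, lists exactly the zeros of \<open>f\<close>, each one as often as its
  multiplicity. Only meant for entire functions that do not vanish identically, where
  \<^const>\<open>zorder\<close> at a zero is the multiplicity.
\<close>

definition lists_zeros :: "(complex \<Rightarrow> complex) \<Rightarrow> 'i set \<Rightarrow> ('i \<Rightarrow> complex) \<Rightarrow> bool" where
  "lists_zeros f I a \<longleftrightarrow>
     (\<forall>i\<in>I. f (a i) = 0) \<and>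
     (\<forall>z. f z = 0 \<longrightarrow>
        finite {i\<in>I. a i = z} \<and> int (card {i\<in>I. a i = z}) = zorder f z)"

end

theory Submission
  imports Defs "Jordan_Normal_Form.Schur_Decomposition"
begin

text \<open>
  Put \<open>a k = x k * x (k + 1)\<close> and \<open>z = w\<^sup>2\<close>. The function \<open>g z = f w\<close> is the limit of the
  polynomials obtained by truncating the sequence \<open>a\<close>, the continuants, and the \<open>n\<close>-th continuant
  at \<open>w\<^sup>2\<close> is \<open>det (1 - w J)\<close> for the symmetric \<open>n \<times> n\<close> tridiagonal matrix \<open>J\<close> with zero
  diagonal and off-diagonal entries \<open>csqrt (a k)\<close>. Hence, if the continuant is written as a finite
  product of factors \<open>1 - z \<mu>\<close> with \<open>\<mu> \<noteq> 0\<close>, the squares of the nonzero eigenvalues of \<open>J\<close>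
  are the numbers \<open>\<mu>\<close>, each taken twice. Schur's inequality bounds the sum of the \<open>\<bar>\<mu>\<bar>\<close> by the sum of
  the \<open>\<bar>a k\<bar>\<close>, uniformly in \<open>n\<close>.

  This alone does not make the limit a product over its zeros: \<open>(1 - z / n) ^ n\<close> tends to
  \<open>exp (- z)\<close>. What excludes an exponential factor is that the small \<open>\<mu>\<close> contribute little,
  uniformly in \<open>n\<close>. Take an orthonormal basis \<open>e i\<close> that triangularises \<open>J\<close>, and split
  \<open>J = B + C\<close>, where \<open>B\<close> is a corner of fixed size and \<open>C\<close> has small Frobenius norm. An eigenvalue
  \<open>\<lambda>\<close> is the diagonal coefficient of \<open>J\<close> in this basis, so
  \<open>\<bar>\<lambda>\<bar>\<^sup>2 \<le> \<bar>\<lambda>\<bar> \<bar>\<langle>B e, e\<rangle>\<bar> + \<bar>\<lambda>\<bar> \<bar>\<langle>C e, e\<rangle>\<bar>\<close>. Summed over the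
  eigenvalues with \<open>\<bar>\<lambda>\<bar> \<le> \<delta>\<close>, the first term gives at most \<open>\<delta>\<close> times the sum of the
  moduli of the entries of \<open>B\<close>, and the second at most the product of the Frobenius norms of \<open>J\<close>
  and \<open>C\<close> (lemmas \<open>eigenvalue_estimates\<close> and \<open>continuant_factorization\<close>).

  Now list the \<open>\<mu>\<close> of the \<open>n\<close>-th continuant by decreasing modulus. The \<open>k\<close>-th one (counted
  from 1) has modulus at most a constant over \<open>k\<close>, so along a subsequence all of them converge, and
  the uniform smallness of the tails lets the products converge to the product over the limits
  (lemma \<open>product_limit\<close>). The limits decrease in modulus as well, so the nonzero ones form an
  initial segment, and the \<open>\<zeta>\<close> are the reciprocals of their square roots.
\<close>

section \<open>Unitary triangularisation of a complex matrix\<close>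

text \<open>
  The entries on and below the diagonal of a product of upper triangular matrices.
\<close>

lemma upper_triangular_mult_entry:
  fixes X Y :: "'a :: comm_ring_1 mat"
  assumes X: "X \<in> carrier_mat n n" and Y: "Y \<in> carrier_mat n n"
    and utX: "upper_triangular X" and utY: "upper_triangular Y"
    and i: "i < n" and ji: "j \<le> i"
  shows "(X * Y) $$ (i, j) = (if j = i then X $$ (i, i) * Y $$ (i, i) else 0)"
proof -
  have "(X * Y) $$ (i, j) = (\<Sum>k\<in>{0..<n}. X $$ (i, k) * Y $$ (k, j))"
    using X Y i ji by (simp add: scalar_prod_def)
  also have "\<dots> = (\<Sum>k\<in>{0..<n}. if k = i then (if j = i then X $$ (i, i) * Y $$ (i, i) else 0) else 0)"
  proof (rule sum.cong)
    fix k assume "k \<in> {0..<n}"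
    then have k: "k < n" by simp
    consider "k < i" | "k = i" | "k > i" by linarith
    then show "X $$ (i, k) * Y $$ (k, j) =
        (if k = i then (if j = i then X $$ (i, i) * Y $$ (i, i) else 0) else 0)"
    proof cases
      case 1
      then have "X $$ (i, k) = 0" using utX X i by (auto simp: upper_triangular_def)
      with 1 show ?thesis by simp
    next
      case 2
      have "Y $$ (i, j) = 0" if "j < i" using utY Y i that by (auto simp: upper_triangular_def)
      with 2 ji show ?thesis by auto
    next
      case 3
      then have "Y $$ (k, j) = 0" using utY Y k ji by (auto simp: upper_triangular_def)
      with 3 show ?thesis by simp
    qed
  qed simp
  also have "\<dots> = (if j = i then X $$ (i, i) * Y $$ (i, i) else 0)"
    using i by simp
  finally show ?thesis .
qed

text \<open>
  A homogeneous system of \<open>i\<close> equations in the \<open>i + 1\<close> unknowns \<open>c 0, \<dots>, c i\<close> has a nontrivial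
  solution: completed by a zero row, its matrix is singular.
\<close>

lemma homogeneous_system_solution:
  fixes g :: "nat \<Rightarrow> nat \<Rightarrow> 'a :: field"
  obtains c where "\<exists>l\<le>i. c l \<noteq> 0" "\<And>m. m < i \<Longrightarrow> (\<Sum>l\<le>i. g m l * c l) = 0"
proof -
  define M where "M = mat (Suc i) (Suc i) (\<lambda>(m, l). if m < i then g m l else 0)"
  have M: "M \<in> carrier_mat (Suc i) (Suc i)" by (simp add: M_def)
  have "Determinant.det M = (\<Sum>j<Suc i. M $$ (i, j) * cofactor M i j)"
    by (rule laplace_expansion_row[OF M]) simp
  also have "\<dots> = 0" by (rule sum.neutral) (simp add: M_def)
  finally obtain v where v: "v \<in> carrier_vec (Suc i)" "v \<noteq> 0\<^sub>v (Suc i)" "M *\<^sub>v v = 0\<^sub>v (Suc i)"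
    using det_0_iff_vec_prod_zero_field[OF M] by blast
  show ?thesis
  proof (rule that[of "\<lambda>l. vec_index v l"])
    show "\<exists>l\<le>i. vec_index v l \<noteq> 0"
    proof (rule ccontr)
      assume "\<not> ?thesis"
      then have "v = 0\<^sub>v (Suc i)" using v(1) by (intro eq_vecI) auto
      with v(2) show False by simp
    qed
    fix m assume m: "m < i"
    have "vec_index (M *\<^sub>v v) m = (\<Sum>l\<in>{0..<Suc i}. M $$ (m, l) * vec_index v l)"
      using M v(1) m by (simp add: scalar_prod_def)
    also have "\<dots> = (\<Sum>l\<le>i. g m l * vec_index v l)"
      using m by (intro sum.cong) (auto simp: M_def)
    finally show "(\<Sum>l\<le>i. g m l * vec_index v l) = 0" using v(3) m by simp
  qed
qed

text \<open>
  Schur's theorem, reduced to what the estimates need: \<open>e i\<close> is the \<open>i\<close>-th basis vector and \<open>e i j\<close>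
  its \<open>j\<close>-th coordinate. The first two conclusions say that the matrix of coordinates is unitary, the
  third that the numbers \<open>ev i\<close> are the diagonal coefficients of \<open>A\<close> in this basis, and the last that
  they are its eigenvalues with multiplicity.

  The decomposition \<open>P * B * Q\<close> supplied by \<open>schur_decomposition\<close> is upper triangular in the basis of
  the columns of \<open>P\<close>, which need not be orthogonal. These columns are made orthonormal by an upper
  triangular matrix \<open>T\<close>, which leaves the diagonal of \<open>B\<close> unchanged.
\<close>

lemma schur_orthonormal_basis:
  fixes A :: "nat \<Rightarrow> nat \<Rightarrow> complex" and n :: nat
  obtains e :: "nat \<Rightarrow> nat \<Rightarrow> complex" and ev :: "nat \<Rightarrow> complex" where
    "\<And>i k. i < n \<Longrightarrow> k < n \<Longrightarrow> (\<Sum>j<n. e i j * cnj (e k j)) = of_bool (i = k)"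
    "\<And>j k. j < n \<Longrightarrow> k < n \<Longrightarrow> (\<Sum>i<n. e i j * cnj (e i k)) = of_bool (j = k)"
    "\<And>i. i < n \<Longrightarrow> ev i = (\<Sum>j<n. cnj (e i j) * (\<Sum>k<n. A j k * e i k))"
    "\<And>w. Determinant.det (mat n n (\<lambda>(j, k). of_bool (j = k) - w * A j k)) = (\<Prod>i<n. 1 - w * ev i)"
proof -
  define M where "M = mat n n (\<lambda>(j, k). A j k)"
  have M: "M \<in> carrier_mat n n" by (simp add: M_def)
  obtain es where es: "char_poly M = (\<Prod>a\<leftarrow>es. [:- a, 1:])" "length es = n"
    using char_poly_factorized[OF M] by blast
  obtain B P Q where "schur_decomposition M es = (B, P, Q)"
    by (cases "schur_decomposition M es") auto
  from schur_decomposition[OF M es(1) this]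
  have sim: "similar_mat_wit M B P Q" and utB: "upper_triangular B" by auto
  note D = similar_mat_witD2[OF M sim]
  note B = D(5) and P = D(6) and Q = D(7)
  \<comment> \<open>The \<open>i\<close>-th column of \<open>E0\<close> is a nontrivial combination of the columns \<open>0, \<dots>, i\<close> of \<open>P\<close> that is
    orthogonal to the columns \<open>0, \<dots>, i - 1\<close>; \<open>gr\<close> is the Gram matrix of the columns of \<open>P\<close>.\<close>
  define gr where "gr = (\<lambda>m l. \<Sum>j<n. cnj (P $$ (j, m)) * P $$ (j, l))"
  have "\<forall>i. \<exists>c. (\<exists>l\<le>i. c l \<noteq> 0) \<and> (\<forall>m<i. (\<Sum>l\<le>i. gr m l * c l) = 0)"
    using homogeneous_system_solution by metis
  then obtain c where c: "\<And>i. \<exists>l\<le>i. c i l \<noteq> 0"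
    "\<And>i m. m < i \<Longrightarrow> (\<Sum>l\<le>i. gr m l * c i l) = 0" by metis
  define T0 where "T0 = mat n n (\<lambda>(l, i). if l \<le> i then c i l else 0)"
  have T0: "T0 \<in> carrier_mat n n" by (simp add: T0_def)
  define E0 where "E0 = P * T0"
  have E0: "E0 \<in> carrier_mat n n" using P T0 by (simp add: E0_def)
  \<comment> \<open>\<open>E\<close> is \<open>E0\<close> with normalised columns, and \<open>H\<close> is its conjugate transpose.\<close>
  define r where "r = (\<lambda>i. sqrt (\<Sum>j<n. (cmod (E0 $$ (j, i)))\<^sup>2))"
  have r: "r i > 0" if i: "i < n" for i
  proof (rule ccontr)
    assume "\<not> r i > 0"
    then have "\<not> (\<Sum>j<n. (cmod (E0 $$ (j, i)))\<^sup>2) > 0" by (simp add: r_def)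
    moreover have "(\<Sum>j<n. (cmod (E0 $$ (j, i)))\<^sup>2) \<ge> 0" by (intro sum_nonneg) simp
    ultimately have "(\<Sum>j<n. (cmod (E0 $$ (j, i)))\<^sup>2) = 0" by linarith
    then have z: "E0 $$ (j, i) = 0" if "j < n" for j
      using that by (subst (asm) sum_nonneg_eq_0_iff) auto
    have "Q * E0 = Q * P * T0" unfolding E0_def using P Q T0 by (intro assoc_mult_mat[symmetric]) auto
    then have "Q * E0 = T0" using D(2) T0 by simp
    moreover have "(Q * E0) $$ (l, i) = 0" if "l < n" for l
      using that i Q E0 z by (simp add: scalar_prod_def)
    ultimately have T0z: "T0 $$ (l, i) = 0" if "l < n" for l using that by simp
    have "c i l = 0" if "l \<le> i" for l
      using T0z[of l] that i by (simp add: T0_def)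
    with c(1) show False by blast
  qed
  define T where "T = mat n n (\<lambda>(l, i). T0 $$ (l, i) / of_real (r i))"
  have T: "T \<in> carrier_mat n n" by (simp add: T_def)
  have utT: "upper_triangular T" by (auto simp: upper_triangular_def T_def T0_def)
  define E where "E = P * T"
  have E: "E \<in> carrier_mat n n" using P T by (simp add: E_def)
  have E_E0: "E $$ (j, i) = E0 $$ (j, i) / of_real (r i)" if "j < n" "i < n" for i j
    using that P T T0 by (simp add: E_def E0_def scalar_prod_def T_def sum_divide_distrib)
  define H where "H = mat n n (\<lambda>(i, j). cnj (E $$ (j, i)))"
  have H: "H \<in> carrier_mat n n" by (simp add: H_def)
  define U where "U = H * P"
  have U: "U \<in> carrier_mat n n" using H P by (simp add: U_def)
  \<comment> \<open>This is the orthogonality of the \<open>i\<close>-th column of \<open>E0\<close> to the earlier columns of \<open>P\<close>.\<close>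
  have utU: "upper_triangular U"
  proof -
    have "U $$ (i, m) = 0" if m: "m < i" and i: "i < n" for i m
    proof -
      have ER: "E0 $$ (j, i) = (\<Sum>l\<le>i. P $$ (j, l) * c i l)" if "j < n" for j
      proof -
        have "E0 $$ (j, i) = (\<Sum>l\<in>{0..<n}. P $$ (j, l) * T0 $$ (l, i))"
          using that i P T0 by (simp add: E0_def scalar_prod_def)
        also have "\<dots> = (\<Sum>l\<le>i. P $$ (j, l) * c i l)"
          using i by (intro sum.mono_neutral_cong_right) (auto simp: T0_def)
        finally show ?thesis .
      qed
      have "U $$ (i, m) = (\<Sum>j<n. cnj (E $$ (j, i)) * P $$ (j, m))"
        using H P i m by (simp add: U_def scalar_prod_def H_def atLeast0LessThan)
      also have "\<dots> = cnj ((\<Sum>j<n. E0 $$ (j, i) * cnj (P $$ (j, m))) / of_real (r i))"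
        using i by (simp add: E_E0 sum_divide_distrib)
      also have "(\<Sum>j<n. E0 $$ (j, i) * cnj (P $$ (j, m))) = (\<Sum>j<n. \<Sum>l\<le>i. cnj (P $$ (j, m)) * P $$ (j, l) * c i l)"
        by (intro sum.cong refl) (simp add: ER sum_distrib_left mult_ac)
      also have "\<dots> = (\<Sum>l\<le>i. gr m l * c i l)"
        by (subst sum.swap) (simp add: gr_def sum_distrib_right)
      also have "\<dots> = 0" using c(2)[OF m] .
      finally show ?thesis by simp
    qed
    then show ?thesis using U by (auto simp: upper_triangular_def)
  qed
  have HE: "H * E = U * T" using H P T by (simp add: U_def E_def assoc_mult_mat[of _ n n _ n _ n])
  have HE_entry: "(H * E) $$ (i, k) = (\<Sum>j<n. cnj (E $$ (j, i)) * E $$ (j, k))" if "i < n" "k < n" for i k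
    using H E that by (simp add: scalar_prod_def H_def atLeast0LessThan)
  have HE_diag: "(H * E) $$ (i, i) = 1" if i: "i < n" for i
  proof -
    have "(H * E) $$ (i, i) = (\<Sum>j<n. of_real ((cmod (E $$ (j, i)))\<^sup>2))"
      unfolding HE_entry[OF i i]
      by (intro sum.cong refl) (simp only: complex_norm_square mult.commute)
    also have "\<dots> = of_real (\<Sum>j<n. (cmod (E0 $$ (j, i)) / r i)\<^sup>2)"
      using i r[OF i] by (simp add: E_E0 norm_divide)
    also have "(\<Sum>j<n. (cmod (E0 $$ (j, i)) / r i)\<^sup>2) = (r i)\<^sup>2 / (r i)\<^sup>2"
      by (simp add: power_divide r_def sum_nonneg flip: sum_divide_distrib)
    finally show ?thesis using r[OF i] by simp
  qed
  have HE_low: "(H * E) $$ (i, k) = 0" if "k < i" "i < n" for i k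
    using upper_triangular_mult_entry[OF U T utU utT] that by (simp add: HE)
  \<comment> \<open>\<open>H * E = U * T\<close> is upper triangular and Hermitian, hence diagonal.\<close>
  have HE1: "H * E = 1\<^sub>m n"
  proof (rule eq_matI)
    fix i k assume "i < dim_row (1\<^sub>m n :: complex mat)" "k < dim_col (1\<^sub>m n :: complex mat)"
    then have ik: "i < n" "k < n" by auto
    have "(H * E) $$ (i, k) = cnj ((H * E) $$ (k, i))"
      using ik by (simp add: HE_entry mult.commute)
    then show "(H * E) $$ (i, k) = 1\<^sub>m n $$ (i, k)"
      using ik HE_low[of i k] HE_low[of k i] HE_diag by (cases i k rule: linorder_cases) auto
  qed (use H E in auto)
  have EH1: "E * H = 1\<^sub>m n" using mat_mult_left_right_inverse[OF H E HE1] .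
  have MP: "M * P = P * B"
  proof -
    have "M * P = P * B * Q * P" using D(3) by simp
    also have "\<dots> = P * B * (Q * P)" using B P Q by (intro assoc_mult_mat[of _ n n]) auto
    finally show ?thesis using D(2) B P by simp
  qed
  have HME: "H * (M * E) = U * (B * T)"
  proof -
    have "M * E = M * P * T" using M P T by (simp add: E_def assoc_mult_mat[of _ n n _ n _ n])
    also have "\<dots> = P * (B * T)" using P B T by (simp add: MP assoc_mult_mat[of _ n n _ n _ n])
    finally show ?thesis using H P B T by (simp add: U_def assoc_mult_mat[of _ n n _ n _ n])
  qed
  have utBT: "upper_triangular (B * T)"
    using upper_triangular_mult_entry[OF B T utB utT] B T by (auto simp: upper_triangular_def)
  have BT: "B * T \<in> carrier_mat n n" using B T by simp
  \<comment> \<open>The diagonal of \<open>H * M * E = U * B * T\<close> is that of \<open>B\<close>, since \<open>U * T = 1\<close>.\<close>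
  have ev: "B $$ (i, i) = (H * (M * E)) $$ (i, i)" if i: "i < n" for i
  proof -
    have "(H * (M * E)) $$ (i, i) = U $$ (i, i) * (B $$ (i, i) * T $$ (i, i))"
      using upper_triangular_mult_entry[OF U BT utU utBT i order_refl]
        upper_triangular_mult_entry[OF B T utB utT i order_refl] by (simp add: HME)
    also have "\<dots> = B $$ (i, i) * (U $$ (i, i) * T $$ (i, i))" by (simp add: mult_ac)
    also have "U $$ (i, i) * T $$ (i, i) = 1"
      using upper_triangular_mult_entry[OF U T utU utT i order_refl] HE_diag[OF i] by (simp add: HE)
    finally show ?thesis by simp
  qed
  show ?thesis
  proof (rule that[of "\<lambda>i j. E $$ (j, i)" "\<lambda>i. B $$ (i, i)"])
    fix i k assume ik: "i < n" "k < n"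
    have "(\<Sum>j<n. E $$ (j, i) * cnj (E $$ (j, k))) = (H * E) $$ (k, i)"
      using ik by (simp add: HE_entry mult.commute)
    then show "(\<Sum>j<n. E $$ (j, i) * cnj (E $$ (j, k))) = of_bool (i = k)"
      using ik by (simp add: HE1)
    have "(\<Sum>l<n. E $$ (i, l) * cnj (E $$ (k, l))) = (E * H) $$ (i, k)"
      using H E ik by (simp add: scalar_prod_def H_def atLeast0LessThan)
    then show "(\<Sum>l<n. E $$ (i, l) * cnj (E $$ (k, l))) = of_bool (i = k)"
      using ik by (simp add: EH1)
  next
    fix i assume i: "i < n"
    show "B $$ (i, i) = (\<Sum>j<n. cnj (E $$ (j, i)) * (\<Sum>k<n. A j k * E $$ (k, i)))"
      unfolding ev[OF i] using i H M E
      by (simp add: scalar_prod_def H_def M_def atLeast0LessThan)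
  next
    fix w
    define N where "N = (\<lambda>X :: complex mat. mat n n (\<lambda>(j, k). of_bool (j = k) - w * X $$ (j, k)))"
    have N: "N X \<in> carrier_mat n n" for X by (simp add: N_def)
    have Neq: "N X = 1\<^sub>m n - w \<cdot>\<^sub>m X" if "X \<in> carrier_mat n n" for X
      using that by (auto simp: N_def intro!: eq_matI)
    have "N M = P * N B * Q"
    proof -
      have "P * N B * Q = P * (N B * Q)" using P N Q by (rule assoc_mult_mat)
      also have "N B * Q = Q - w \<cdot>\<^sub>m (B * Q)"
        using B Q by (simp add: Neq minus_mult_distrib_mat[of _ n n] mult_smult_assoc_mat[of _ n n])
      also have "P * (Q - w \<cdot>\<^sub>m (B * Q)) = P * Q - w \<cdot>\<^sub>m (P * (B * Q))"
        using P B Q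
          by (simp add: mult_minus_distrib_mat[of P n n Q n] mult_smult_distrib[of P n n "B * Q" n])
      also have "P * (B * Q) = M" using P B Q D(3) by (simp add: assoc_mult_mat[of _ n n _ n _ n])
      finally show ?thesis using D(1) M by (simp add: Neq)
    qed
    then have "similar_mat (N M) (N B)"
      using N P Q D(1,2) by (intro similar_matI[of _ _ P Q n]) auto
    then have "Determinant.det (N M) = Determinant.det (N B)" by (rule det_similar)
    also have "\<dots> = prod_list (diag_mat (N B))"
      using N utB B by (intro det_upper_triangular) (auto simp: N_def upper_triangular_def)
    also have "\<dots> = (\<Prod>i<n. 1 - w * B $$ (i, i))"
      by (simp add: diag_mat_def N_def prod.list_conv_set_nth atLeast0LessThan)
    also have "N M = mat n n (\<lambda>(j, k). of_bool (j = k) - w * A j k)"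
      by (auto simp: N_def M_def intro!: eq_matI)
    finally show "Determinant.det (mat n n (\<lambda>(j, k). of_bool (j = k) - w * A j k)) =
        (\<Prod>i<n. 1 - w * B $$ (i, i))" .
  qed
qed

section \<open>Estimates for sums of eigenvalues\<close>

text \<open>
  Parseval's identity: \<open>e\<close> is a matrix with orthonormal columns, here applied to \<open>v\<close>.
\<close>

lemma parseval_finite:
  fixes e :: "nat \<Rightarrow> nat \<Rightarrow> complex"
  assumes "\<And>j k. j < n \<Longrightarrow> k < n \<Longrightarrow> (\<Sum>i<n. e i j * cnj (e i k)) = of_bool (j = k)"
  shows "(\<Sum>i<n. (cmod (\<Sum>k<n. v k * e i k))\<^sup>2) = (\<Sum>k<n. (cmod (v k))\<^sup>2)"
proof -
  have "complex_of_real (\<Sum>i<n. (cmod (\<Sum>k<n. v k * e i k))\<^sup>2)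
      = (\<Sum>i<n. (\<Sum>k<n. v k * e i k) * (\<Sum>l<n. cnj (v l * e i l)))"
    by (simp only: of_real_sum complex_norm_square cnj_sum)
  also have "\<dots> = (\<Sum>i<n. \<Sum>k<n. \<Sum>l<n. v k * cnj (v l) * (e i k * cnj (e i l)))"
    by (simp add: sum_product mult_ac)
  also have "\<dots> = (\<Sum>k<n. \<Sum>i<n. \<Sum>l<n. v k * cnj (v l) * (e i k * cnj (e i l)))"
    by (rule sum.swap)
  also have "\<dots> = (\<Sum>k<n. \<Sum>l<n. \<Sum>i<n. v k * cnj (v l) * (e i k * cnj (e i l)))"
    by (intro sum.cong refl sum.swap)
  also have "\<dots> = (\<Sum>k<n. \<Sum>l<n. v k * cnj (v l) * (\<Sum>i<n. e i k * cnj (e i l)))"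
    by (simp add: sum_distrib_left)
  also have "\<dots> = (\<Sum>k<n. \<Sum>l<n. if l = k then v k * cnj (v l) else 0)"
    by (intro sum.cong refl) (simp add: assms)
  also have "\<dots> = (\<Sum>k<n. v k * cnj (v k))" by simp
  also have "\<dots> = complex_of_real (\<Sum>k<n. (cmod (v k))\<^sup>2)"
    by (simp only: of_real_sum complex_norm_square)
  finally show ?thesis by (simp only: of_real_eq_iff)
qed

text \<open>
  The square of the Frobenius norm of the \<open>n \<times> n\<close> matrix with entries \<open>A j k\<close>, where \<open>j, k < n\<close>.
\<close>

definition frob :: "nat \<Rightarrow> (nat \<Rightarrow> nat \<Rightarrow> complex) \<Rightarrow> real" where
  "frob n A = (\<Sum>j<n. \<Sum>k<n. (cmod (A j k))\<^sup>2)"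

lemma frob_nonneg: "frob n A \<ge> 0"
  by (simp add: frob_def sum_nonneg)

text \<open>
  The second conclusion is Schur's inequality. The third refines it for the eigenvalues of modulus at
  most \<open>\<delta>\<close>: the matrix \<open>B\<close> is arbitrary, and is meant to be an approximation of \<open>A\<close> with few
  entries.
\<close>

lemma eigenvalue_estimates:
  fixes A :: "nat \<Rightarrow> nat \<Rightarrow> complex" and n :: nat
  obtains ev :: "nat \<Rightarrow> complex" where
    "\<And>w. Determinant.det (mat n n (\<lambda>(j, k). of_bool (j = k) - w * A j k)) = (\<Prod>i<n. 1 - w * ev i)"
    "(\<Sum>i<n. (cmod (ev i))\<^sup>2) \<le> frob n A"
    "\<And>\<delta> B. \<delta> \<ge> 0 \<Longrightarrow> (\<Sum>i<n. if cmod (ev i) \<le> \<delta> then (cmod (ev i))\<^sup>2 else 0)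
       \<le> \<delta> * (\<Sum>j<n. \<Sum>k<n. cmod (B j k)) + sqrt (frob n A) * sqrt (frob n (\<lambda>j k. A j k - B j k))"
proof -
  obtain e ev where on: "\<And>i k. i < n \<Longrightarrow> k < n \<Longrightarrow> (\<Sum>j<n. e i j * cnj (e k j)) = of_bool (i = k)"
    and comp: "\<And>j k. j < n \<Longrightarrow> k < n \<Longrightarrow> (\<Sum>i<n. e i j * cnj (e i k)) = of_bool (j = k)"
    and ev: "\<And>i. i < n \<Longrightarrow> ev i = (\<Sum>j<n. cnj (e i j) * (\<Sum>k<n. A j k * e i k))"
    and det: "\<And>w. Determinant.det (mat n n (\<lambda>(j, k). of_bool (j = k) - w * A j k)) = (\<Prod>i<n. 1 - w * ev i)"
    by (rule schur_orthonormal_basis[of n A]) (rule that)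
  \<comment> \<open>\<open>q C i\<close> is the \<open>i\<close>-th diagonal coefficient of \<open>C\<close> in the basis \<open>e\<close>.\<close>
  define q where "q = (\<lambda>C i. \<Sum>j<n. cnj (e i j) * (\<Sum>k<n. C j k * e i k))"
  have row: "(\<Sum>j<n. (cmod (e i j))\<^sup>2) = 1" if "i < n" for i
  proof -
    have "complex_of_real (\<Sum>j<n. (cmod (e i j))\<^sup>2) = 1"
      unfolding of_real_sum complex_norm_square using on[OF that that] by simp
    then show ?thesis by (simp only: of_real_eq_1_iff)
  qed
  have col: "(\<Sum>i<n. (cmod (e i j))\<^sup>2) = 1" if "j < n" for j
  proof -
    have "complex_of_real (\<Sum>i<n. (cmod (e i j))\<^sup>2) = 1"
      unfolding of_real_sum complex_norm_square using comp[OF that that] by simp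
    then show ?thesis by (simp only: of_real_eq_1_iff)
  qed
  have q_frob: "(\<Sum>i<n. (cmod (q C i))\<^sup>2) \<le> frob n C" for C
  proof -
    have "(cmod (q C i))\<^sup>2 \<le> (\<Sum>j<n. (cmod (\<Sum>k<n. C j k * e i k))\<^sup>2)" if "i < n" for i
    proof -
      have "cmod (q C i) \<le> (\<Sum>j<n. \<bar>cmod (e i j)\<bar> * \<bar>cmod (\<Sum>k<n. C j k * e i k)\<bar>)"
        unfolding q_def by (rule sum_norm_le) (simp add: norm_mult)
      also have "\<dots> \<le> L2_set (\<lambda>j. cmod (e i j)) {..<n} * L2_set (\<lambda>j. cmod (\<Sum>k<n. C j k * e i k)) {..<n}"
        by (rule L2_set_mult_ineq)
      also have "\<dots> = L2_set (\<lambda>j. cmod (\<Sum>k<n. C j k * e i k)) {..<n}"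
        using row[OF that] by (simp add: L2_set_def)
      finally have "(cmod (q C i))\<^sup>2 \<le> (L2_set (\<lambda>j. cmod (\<Sum>k<n. C j k * e i k)) {..<n})\<^sup>2"
        by (intro power_mono) auto
      then show ?thesis by (simp add: L2_set_def sum_nonneg)
    qed
    then have "(\<Sum>i<n. (cmod (q C i))\<^sup>2) \<le> (\<Sum>i<n. \<Sum>j<n. (cmod (\<Sum>k<n. C j k * e i k))\<^sup>2)"
      by (intro sum_mono) simp
    also have "\<dots> = (\<Sum>j<n. \<Sum>i<n. (cmod (\<Sum>k<n. C j k * e i k))\<^sup>2)" by (rule sum.swap)
    also have "\<dots> = frob n C"
      unfolding frob_def by (intro sum.cong refl parseval_finite comp)
    finally show ?thesis .
  qed
  have q_l1: "(\<Sum>i<n. cmod (q C i)) \<le> (\<Sum>j<n. \<Sum>k<n. cmod (C j k))" for C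
  proof -
    have "cmod (q C i) \<le> (\<Sum>j<n. \<Sum>k<n. cmod (C j k) * (((cmod (e i j))\<^sup>2 + (cmod (e i k))\<^sup>2) / 2))" for i
    proof -
      have "q C i = (\<Sum>j<n. \<Sum>k<n. cnj (e i j) * (C j k * e i k))"
        by (simp add: q_def sum_distrib_left)
      also have "cmod \<dots> \<le> (\<Sum>j<n. \<Sum>k<n. cmod (C j k) * (((cmod (e i j))\<^sup>2 + (cmod (e i k))\<^sup>2) / 2))"
      proof (intro sum_norm_le)
        fix j k
        have "cmod (e i j) * cmod (e i k) \<le> ((cmod (e i j))\<^sup>2 + (cmod (e i k))\<^sup>2) / 2"
          using sum_squares_bound[of "cmod (e i j)" "cmod (e i k)"] by simp
        then have "cmod (C j k) * (cmod (e i j) * cmod (e i k)) \<le> cmod (C j k) * (((cmod (e i j))\<^sup>2 + (cmod (e i k))\<^sup>2) / 2)"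
          by (rule mult_left_mono) simp
        then show "cmod (cnj (e i j) * (C j k * e i k)) \<le> cmod (C j k) * (((cmod (e i j))\<^sup>2 + (cmod (e i k))\<^sup>2) / 2)"
          by (simp add: norm_mult mult_ac)
      qed
      finally show ?thesis .
    qed
    then have "(\<Sum>i<n. cmod (q C i)) \<le> (\<Sum>i<n. \<Sum>j<n. \<Sum>k<n. cmod (C j k) * (((cmod (e i j))\<^sup>2 + (cmod (e i k))\<^sup>2) / 2))"
      by (intro sum_mono)
    also have "\<dots> = (\<Sum>j<n. \<Sum>i<n. \<Sum>k<n. cmod (C j k) * (((cmod (e i j))\<^sup>2 + (cmod (e i k))\<^sup>2) / 2))"
      by (rule sum.swap)
    also have "\<dots> = (\<Sum>j<n. \<Sum>k<n. \<Sum>i<n. cmod (C j k) * (((cmod (e i j))\<^sup>2 + (cmod (e i k))\<^sup>2) / 2))"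
      by (intro sum.cong refl sum.swap)
    also have "\<dots> = (\<Sum>j<n. \<Sum>k<n. cmod (C j k) * (((\<Sum>i<n. (cmod (e i j))\<^sup>2) + (\<Sum>i<n. (cmod (e i k))\<^sup>2)) / 2))"
      by (simp only: sum_distrib_left[symmetric] sum_divide_distrib[symmetric] sum.distrib)
    also have "\<dots> = (\<Sum>j<n. \<Sum>k<n. cmod (C j k))"
      by (intro sum.cong refl) (simp add: col)
    finally show ?thesis .
  qed
  have evq: "ev i = q A i" if "i < n" for i using ev[OF that] by (simp add: q_def)
  have schur: "(\<Sum>i<n. (cmod (ev i))\<^sup>2) \<le> frob n A"
    using q_frob[of A] by (simp add: evq)
  show ?thesis
  proof (rule that[OF det schur])
    fix \<delta> :: real and B
    assume \<delta>: "\<delta> \<ge> 0"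
    define C where "C = (\<lambda>j k. A j k - B j k)"
    have split: "q A i = q B i + q C i" for i
      by (simp add: q_def C_def algebra_simps sum.distrib sum_subtractf sum_distrib_left)
    have "(\<Sum>i<n. if cmod (ev i) \<le> \<delta> then (cmod (ev i))\<^sup>2 else 0)
        \<le> (\<Sum>i<n. \<delta> * cmod (q B i) + \<bar>cmod (ev i)\<bar> * \<bar>cmod (q C i)\<bar>)"
    proof (rule sum_mono)
      fix i assume "i \<in> {..<n}"
      then have i: "i < n" by simp
      show "(if cmod (ev i) \<le> \<delta> then (cmod (ev i))\<^sup>2 else 0) \<le> \<delta> * cmod (q B i) + \<bar>cmod (ev i)\<bar> * \<bar>cmod (q C i)\<bar>"
      proof (cases "cmod (ev i) \<le> \<delta>")
        case True
        have "(cmod (ev i))\<^sup>2 \<le> cmod (ev i) * (cmod (q B i) + cmod (q C i))"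
          unfolding power2_eq_square
          using norm_triangle_ineq[of "q B i" "q C i"] evq[OF i] split[of i]
          by (intro mult_left_mono) auto
        also have "\<dots> \<le> \<delta> * cmod (q B i) + cmod (ev i) * cmod (q C i)"
          unfolding distrib_left using True by (intro add_mono mult_right_mono) auto
        finally show ?thesis using True by simp
      qed (use \<delta> in auto)
    qed
    also have "\<dots> = \<delta> * (\<Sum>i<n. cmod (q B i)) + (\<Sum>i<n. \<bar>cmod (ev i)\<bar> * \<bar>cmod (q C i)\<bar>)"
      by (simp add: sum.distrib sum_distrib_left)
    also have "\<dots> \<le> \<delta> * (\<Sum>j<n. \<Sum>k<n. cmod (B j k)) + sqrt (frob n A) * sqrt (frob n C)"
    proof (intro add_mono mult_left_mono q_l1 \<delta>)
      have "(\<Sum>i<n. \<bar>cmod (ev i)\<bar> * \<bar>cmod (q C i)\<bar>)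
          \<le> L2_set (\<lambda>i. cmod (ev i)) {..<n} * L2_set (\<lambda>i. cmod (q C i)) {..<n}"
        by (rule L2_set_mult_ineq)
      also have "\<dots> \<le> sqrt (frob n A) * sqrt (frob n C)"
        unfolding L2_set_def using schur q_frob[of C]
        by (intro mult_mono) (auto simp: frob_nonneg sum_nonneg)
      finally show "(\<Sum>i<n. \<bar>cmod (ev i)\<bar> * \<bar>cmod (q C i)\<bar>) \<le> sqrt (frob n A) * sqrt (frob n C)" .
    qed
    finally show "(\<Sum>i<n. if cmod (ev i) \<le> \<delta> then (cmod (ev i))\<^sup>2 else 0)
       \<le> \<delta> * (\<Sum>j<n. \<Sum>k<n. cmod (B j k)) + sqrt (frob n A) * sqrt (frob n (\<lambda>j k. A j k - B j k))"
      by (simp add: C_def)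
  qed
qed

section \<open>Continuants and tridiagonal determinants\<close>

text \<open>
  The continuant is the polynomial \<open>\<Sum> (- z) ^ m * a k1 * \<dots> * a km\<close>, where the sum is over all
  \<open>m\<close> and all \<open>k1, \<dots>, km\<close> with \<open>ki + 2 \<le> n\<close> such that each index exceeds the preceding one
  by at least 2. The recursion splits it according to whether \<open>k1 = 0\<close>. Since \<open>n\<close> is the size of the
  corresponding tridiagonal matrix, only the first \<open>n - 1\<close> values of \<open>a\<close> enter.
\<close>

fun continuant :: "(nat \<Rightarrow> complex) \<Rightarrow> nat \<Rightarrow> complex poly" where
  "continuant a 0 = 1"
| "continuant a (Suc 0) = 1"
| "continuant a (Suc (Suc n)) =
     continuant (\<lambda>k. a (Suc k)) (Suc n) - pCons 0 (Polynomial.smult (a 0) (continuant (\<lambda>k. a (Suc (Suc k))) n))"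


text \<open>
  The symmetric tridiagonal matrix with zero diagonal and off-diagonal entries \<open>s 0, s 1, \<dots>\<close>.
\<close>

definition tridiag :: "(nat \<Rightarrow> complex) \<Rightarrow> nat \<Rightarrow> nat \<Rightarrow> complex" where
  "tridiag s j k = (if k = Suc j then s j else if j = Suc k then s k else 0)"

lemma sum_tridiag_le:
  fixes h :: "complex \<Rightarrow> real"
  assumes "\<And>u. h u \<ge> 0" "h 0 = 0"
  shows "(\<Sum>j<n. \<Sum>k<n. h (tridiag s j k)) \<le> 2 * (\<Sum>k<n. h (s k))"
proof -
  have "h (tridiag s j k) = (if k = Suc j then h (s j) else 0) + (if j = Suc k then h (s k) else 0)" for j k
    using assms(2) by (auto simp: tridiag_def)
  then have "(\<Sum>j<n. \<Sum>k<n. h (tridiag s j k))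
      = (\<Sum>j<n. \<Sum>k<n. if k = Suc j then h (s j) else 0) + (\<Sum>j<n. \<Sum>k<n. if j = Suc k then h (s k) else 0)"
    by (simp add: sum.distrib)
  also have "(\<Sum>j<n. \<Sum>k<n. if j = Suc k then h (s k) else 0) = (\<Sum>k<n. \<Sum>j<n. if j = Suc k then h (s k) else 0)"
    by (rule sum.swap)
  also have "(\<Sum>j<n. \<Sum>k<n. if k = Suc j then h (s j) else 0) + \<dots> \<le> (\<Sum>k<n. h (s k)) + (\<Sum>k<n. h (s k))"
    using assms by (intro add_mono sum_mono) (auto simp: sum.delta)
  finally show ?thesis by simp
qed

text \<open>
  The matrix \<open>1 - w J\<close>, where \<open>J\<close> is the leading \<open>n \<times> n\<close> block of \<open>tridiag s\<close>.
\<close>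

definition tridiag_mat :: "(nat \<Rightarrow> complex) \<Rightarrow> complex \<Rightarrow> nat \<Rightarrow> complex mat" where
  "tridiag_mat s w n = mat n n (\<lambda>(j, k). of_bool (j = k) - w * tridiag s j k)"

lemma tridiag_mat_carrier: "tridiag_mat s w n \<in> carrier_mat n n"
  by (simp add: tridiag_mat_def)

lemma det_tridiag_mat_rec:
  "Determinant.det (tridiag_mat s w (Suc (Suc n))) =
     Determinant.det (tridiag_mat (\<lambda>k. s (Suc k)) w (Suc n))
     - w\<^sup>2 * (s 0)\<^sup>2 * Determinant.det (tridiag_mat (\<lambda>k. s (Suc (Suc k))) w n)"
proof -
  define T where "T = tridiag_mat s w (Suc (Suc n))"
  have T: "T \<in> carrier_mat (Suc (Suc n)) (Suc (Suc n))" by (simp add: T_def tridiag_mat_def)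
  define R where "R = mat_delete T 0 1"
  have R: "R \<in> carrier_mat (Suc n) (Suc n)" using T by (auto simp: R_def mat_delete_def)
  have D0: "mat_delete T 0 0 = tridiag_mat (\<lambda>k. s (Suc k)) w (Suc n)"
    by (rule eq_matI) (auto simp: T_def mat_delete_def tridiag_mat_def tridiag_def)
  have R0: "mat_delete R 0 0 = tridiag_mat (\<lambda>k. s (Suc (Suc k))) w n"
    by (rule eq_matI) (auto simp: R_def T_def mat_delete_def tridiag_mat_def tridiag_def)
  have "Determinant.det R = (\<Sum>i<Suc n. R $$ (i, 0) * cofactor R i 0)"
    by (rule laplace_expansion_column[OF R]) simp
  also have "\<dots> = R $$ (0, 0) * cofactor R 0 0 + (\<Sum>i<n. R $$ (Suc i, 0) * cofactor R (Suc i) 0)"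
    by (simp only: sum.lessThan_Suc_shift)
  also have "(\<Sum>i<n. R $$ (Suc i, 0) * cofactor R (Suc i) 0) = 0"
    by (rule sum.neutral) (auto simp: R_def T_def mat_delete_def tridiag_mat_def tridiag_def)
  also have "R $$ (0, 0) * cofactor R 0 0 = - w * s 0 * Determinant.det (tridiag_mat (\<lambda>k. s (Suc (Suc k))) w n)"
    unfolding cofactor_def R0 by (simp add: R_def T_def mat_delete_def tridiag_mat_def tridiag_def)
  finally have detR: "Determinant.det R = - w * s 0 * Determinant.det (tridiag_mat (\<lambda>k. s (Suc (Suc k))) w n)"
    by simp
  have "Determinant.det T = (\<Sum>j<Suc (Suc n). T $$ (0, j) * cofactor T 0 j)"
    by (rule laplace_expansion_row[OF T]) simp
  also have "\<dots> = T $$ (0, 0) * cofactor T 0 0 + (T $$ (0, 1) * cofactor T 0 1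
      + (\<Sum>j<n. T $$ (0, Suc (Suc j)) * cofactor T 0 (Suc (Suc j))))"
    by (simp only: sum.lessThan_Suc_shift One_nat_def)
  also have "(\<Sum>j<n. T $$ (0, Suc (Suc j)) * cofactor T 0 (Suc (Suc j))) = 0"
    by (rule sum.neutral) (auto simp: T_def tridiag_mat_def tridiag_def)
  also have "T $$ (0, 0) * cofactor T 0 0 = Determinant.det (tridiag_mat (\<lambda>k. s (Suc k)) w (Suc n))"
    unfolding cofactor_def D0 by (simp add: T_def tridiag_mat_def tridiag_def)
  also have "T $$ (0, 1) * cofactor T 0 1 = w * s 0 * Determinant.det R"
    by (simp add: cofactor_def R_def T_def tridiag_mat_def tridiag_def)
  finally show ?thesis
    unfolding T_def[symmetric] detR by (simp add: power2_eq_square mult_ac)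
qed

lemma det_tridiag_mat:
  "Determinant.det (tridiag_mat s w n) = poly (continuant (\<lambda>k. (s k)\<^sup>2) n) (w\<^sup>2)"
proof (induction n arbitrary: s rule: induct_nat_012)
  case 0
  then show ?case using tridiag_mat_carrier[of s w 0] by (simp add: det_dim_zero)
next
  case 1
  then show ?case using tridiag_mat_carrier[of s w 1]
    by (simp add: det_single tridiag_mat_def tridiag_def)
next
  case (ge2 n)
  then show ?case by (simp add: det_tridiag_mat_rec mult_ac)
qed

lemma coeff_0_continuant: "Polynomial.coeff (continuant a n) 0 = 1"
  by (induction a n rule: continuant.induct) auto

lemma reciprocal_root_factorization:
  fixes p :: "complex poly"
  assumes "Polynomial.coeff p 0 = 1"
  obtains M where "0 \<notin># M" "p = (\<Prod>\<mu>\<in>#M. [:1, - \<mu>:])"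
proof -
  have "\<exists>M. 0 \<notin># M \<and> p = (\<Prod>\<mu>\<in>#M. [:1, - \<mu>:])" using assms
  proof (induction "degree p" arbitrary: p)
    case 0
    then have "p = [:1:]" by (metis degree_0_id coeff_pCons_0 degree_eq_zeroE)
    then show ?case by (intro exI[of _ "{#}"]) (simp add: one_pCons)
  next
    case (Suc d)
    then have "\<not> constant (poly p)" by (simp add: constant_degree)
    then obtain r where r: "poly p r = 0" using fundamental_theorem_of_algebra by blast
    then obtain q where q: "p = [:- r, 1:] * q" by (auto simp: poly_eq_0_iff_dvd elim: dvdE)
    have r0: "r \<noteq> 0" using r Suc.prems by (auto simp: poly_0_coeff_0)
    have "[:- r, 1:] = Polynomial.smult (- r) [:1, - (1 / r):]" using r0 by simp
    then have p: "p = [:1, - (1 / r):] * Polynomial.smult (- r) q"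
      unfolding q by (simp only: mult_smult_left mult_smult_right)
    define q' where "q' = Polynomial.smult (- r) q"
    have "q' \<noteq> 0" using p Suc.prems by (auto simp: q'_def)
    then have "degree p = Suc (degree q')"
      unfolding p q'_def[symmetric] using r0 by (subst degree_mult_eq) auto
    moreover have "Polynomial.coeff q' 0 = 1" using Suc.prems unfolding p q'_def[symmetric] by (simp add: mult.commute)
    ultimately obtain M where M: "0 \<notin># M" "q' = (\<Prod>\<mu>\<in>#M. [:1, - \<mu>:])" using Suc by (metis Suc_inject)
    show ?case using M r0 by (intro exI[of _ "add_mset (1 / r) M"]) (simp add: p q'_def)
  qed
  with that show ?thesis by blast
qed

lemma reciprocal_roots_unique:
  fixes M N :: "complex multiset"
  assumes "0 \<notin># M" "0 \<notin># N" "(\<Prod>\<mu>\<in>#M. [:1, - \<mu>:]) = (\<Prod>\<mu>\<in>#N. [:1, - \<mu>:])"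
  shows "M = N"
  using assms
proof (induction M arbitrary: N)
  case empty
  show ?case
  proof (rule ccontr)
    assume "{#} \<noteq> N"
    then obtain \<mu> N' where N: "N = add_mset \<mu> N'" by (metis multi_nonempty_split)
    have "\<mu> \<noteq> 0" using N empty.prems(2) by auto
    then have "poly (\<Prod>\<mu>\<in>#N. [:1, - \<mu>:]) (1 / \<mu>) = 0" by (simp add: N)
    then show False unfolding empty.prems(3)[symmetric] by simp
  qed
next
  case (add \<mu> M)
  have \<mu>: "\<mu> \<noteq> 0" using add.prems by auto
  have "poly (\<Prod>\<mu>\<in>#N. [:1, - \<mu>:]) (1 / \<mu>) = 0"
    unfolding add.prems(3)[symmetric] using \<mu> by simp
  then have "(\<Prod>\<nu>\<in>#N. 1 - \<nu> / \<mu>) = 0" by (simp add: poly_prod_mset image_mset.compositionality o_def)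
  then obtain \<nu> where "\<nu> \<in># N" "1 - \<nu> / \<mu> = 0" by (auto simp: prod_mset_zero_iff)
  then have "\<mu> \<in># N" using \<mu> by (simp add: field_simps)
  then obtain N' where N: "N = add_mset \<mu> N'" by (metis mset_add)
  have "[:1, - \<mu>:] * (\<Prod>\<mu>\<in>#M. [:1, - \<mu>:]) = [:1, - \<mu>:] * (\<Prod>\<mu>\<in>#N'. [:1, - \<mu>:])"
    using add.prems(3) unfolding N by (simp only: image_mset_add_mset prod_mset.add_mset)
  then have "(\<Prod>\<mu>\<in>#M. [:1, - \<mu>:]) = (\<Prod>\<mu>\<in>#N'. [:1, - \<mu>:])"
    by (subst (asm) mult_left_cancel) auto
  then have "M = N'" using add.prems(1,2) by (intro add.IH) (auto simp: N)
  then show ?case using N by simp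
qed


text \<open>
  The multiset \<open>M\<close> consists of the reciprocals of the roots of the continuant. In the last bound the
  second summand becomes small as \<open>K\<close> grows, and then the first as \<open>\<delta>\<close> tends to 0; both do so
  uniformly in \<open>n\<close> if \<open>a\<close> is absolutely summable.
\<close>

lemma continuant_factorization:
  fixes a :: "nat \<Rightarrow> complex" and n :: nat
  obtains M where
    "\<And>z. poly (continuant a n) z = (\<Prod>\<mu>\<in>#M. 1 - z * \<mu>)"
    "(\<Sum>\<mu>\<in>#M. cmod \<mu>) \<le> (\<Sum>k<n. cmod (a k))"
    "\<And>\<delta> K. \<delta> \<ge> 0 \<Longrightarrow> (\<Sum>\<mu>\<in>#M. if cmod \<mu> \<le> \<delta>\<^sup>2 then cmod \<mu> else 0)
       \<le> \<delta> * (\<Sum>k<K. sqrt (cmod (a k))) + sqrt (\<Sum>k<n. cmod (a k)) * sqrt (\<Sum>k\<in>{K..<n}. cmod (a k))"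
proof -
  obtain M where M: "0 \<notin># M" "continuant a n = (\<Prod>\<mu>\<in>#M. [:1, - \<mu>:])"
    using reciprocal_root_factorization[OF coeff_0_continuant] by blast
  define s where "s = (\<lambda>k. csqrt (a k))"
  have s2: "(cmod (s k))\<^sup>2 = cmod (a k)" for k by (simp add: s_def flip: norm_power)
  then have s1: "cmod (s k) = sqrt (cmod (a k))" for k
    by (metis real_sqrt_abs abs_norm_cancel)
  obtain ev where
    det: "\<And>w. Determinant.det (mat n n (\<lambda>(j, k). of_bool (j = k) - w * tridiag s j k)) = (\<Prod>i<n. 1 - w * ev i)"
    and total: "(\<Sum>i<n. (cmod (ev i))\<^sup>2) \<le> frob n (tridiag s)"
    and small: "\<And>\<delta> B. \<delta> \<ge> 0 \<Longrightarrow> (\<Sum>i<n. if cmod (ev i) \<le> \<delta> then (cmod (ev i))\<^sup>2 else 0)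
       \<le> \<delta> * (\<Sum>j<n. \<Sum>k<n. cmod (B j k)) + sqrt (frob n (tridiag s)) * sqrt (frob n (\<lambda>j k. tridiag s j k - B j k))"
    by (rule eigenvalue_estimates[of n "tridiag s"]) (rule that)
  have cont: "poly (continuant a n) (w\<^sup>2) = (\<Prod>i<n. 1 - w * ev i)" for w
    using det_tridiag_mat[of s w n] det[of w] by (simp add: tridiag_mat_def s_def)
  \<comment> \<open>\<open>L\<close> collects the squares of the nonzero eigenvalues. The square of the continuant is the product
    of the factors \<open>1 - z * \<kappa>\<close> over \<open>\<kappa>\<close> in \<open>L\<close>, whence \<open>L\<close> is \<open>M\<close> taken twice.\<close>
  define L where "L = image_mset (\<lambda>i. (ev i)\<^sup>2) (mset_set {i\<in>{..<n}. ev i \<noteq> 0})"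
  have L0: "0 \<notin># L" by (auto simp: L_def)
  have "(\<Prod>\<kappa>\<in>#L. [:1, - \<kappa>:]) = continuant a n * continuant a n"
  proof (rule poly_eq_poly_eq_iff[THEN iffD1], rule ext)
    fix z :: complex
    define w where "w = csqrt z"
    have z: "z = w\<^sup>2" "z = (- w)\<^sup>2" by (simp_all add: w_def)
    have "poly (\<Prod>\<kappa>\<in>#L. [:1, - \<kappa>:]) z = (\<Prod>i\<in>{i\<in>{..<n}. ev i \<noteq> 0}. 1 - z * (ev i)\<^sup>2)"
      by (simp add: L_def poly_prod_mset image_mset.compositionality o_def prod_unfold_prod_mset)
    also have "\<dots> = (\<Prod>i<n. 1 - z * (ev i)\<^sup>2)"
      by (intro prod.mono_neutral_left) auto
    also have "\<dots> = (\<Prod>i<n. (1 - w * ev i) * (1 - (- w) * ev i))"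
      by (intro prod.cong refl) (simp add: z(1) power2_eq_square algebra_simps)
    also have "\<dots> = poly (continuant a n) z * poly (continuant a n) z"
      unfolding prod.distrib cont[symmetric] z[symmetric] by simp
    finally show "poly (\<Prod>\<kappa>\<in>#L. [:1, - \<kappa>:]) z = poly (continuant a n * continuant a n) z" by simp
  qed
  then have "(\<Prod>\<kappa>\<in>#L. [:1, - \<kappa>:]) = (\<Prod>\<kappa>\<in>#M + M. [:1, - \<kappa>:])" by (simp add: M(2))
  then have LM: "L = M + M" using L0 M(1) by (intro reciprocal_roots_unique) auto
  have transfer: "2 * (\<Sum>\<mu>\<in>#M. h \<mu>) = (\<Sum>i<n. h ((ev i)\<^sup>2))" if "h 0 = 0" for h :: "complex \<Rightarrow> real"
  proof -
    have "2 * (\<Sum>\<mu>\<in>#M. h \<mu>) = (\<Sum>\<mu>\<in>#L. h \<mu>)" by (simp add: LM)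
    also have "\<dots> = (\<Sum>i\<in>{i\<in>{..<n}. ev i \<noteq> 0}. h ((ev i)\<^sup>2))"
      by (simp add: L_def image_mset.compositionality o_def sum_unfold_sum_mset)
    also have "\<dots> = (\<Sum>i<n. h ((ev i)\<^sup>2))"
      using that by (intro sum.mono_neutral_left) auto
    finally show ?thesis .
  qed
  have frob: "frob n (tridiag s) \<le> 2 * (\<Sum>k<n. cmod (a k))"
    unfolding frob_def using sum_tridiag_le[where h = "\<lambda>u. (cmod u)\<^sup>2" and n = n and s = s] by (simp add: s2)
  show ?thesis
  proof (rule that)
    show "poly (continuant a n) z = (\<Prod>\<mu>\<in>#M. 1 - z * \<mu>)" for z
      by (simp add: M(2) poly_prod_mset image_mset.compositionality o_def)
    have "2 * (\<Sum>\<mu>\<in>#M. cmod \<mu>) = (\<Sum>i<n. (cmod (ev i))\<^sup>2)"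
      using transfer[of cmod] by (simp add: norm_power)
    also have "\<dots> \<le> 2 * (\<Sum>k<n. cmod (a k))" using total frob by (rule order_trans)
    finally show "(\<Sum>\<mu>\<in>#M. cmod \<mu>) \<le> (\<Sum>k<n. cmod (a k))"
      by (rule mult_left_le_imp_le) simp
    fix \<delta> :: real and K
    assume \<delta>: "\<delta> \<ge> 0"
    \<comment> \<open>The comparison matrix keeps the first \<open>K\<close> off-diagonal entries.\<close>
    define B where "B = tridiag (\<lambda>k. if k < K then s k else 0)"
    have rest: "(\<lambda>j k. tridiag s j k - B j k) = tridiag (\<lambda>k. if k < K then 0 else s k)"
      by (auto simp: B_def tridiag_def fun_eq_iff)
    have "(\<Sum>j<n. \<Sum>k<n. cmod (B j k)) \<le> 2 * (\<Sum>k<n. cmod (if k < K then s k else 0))"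
      unfolding B_def by (rule sum_tridiag_le) auto
    also have "(\<Sum>k<n. cmod (if k < K then s k else 0)) = (\<Sum>k<min n K. cmod (s k))"
      by (intro sum.mono_neutral_cong_right) auto
    also have "\<dots> \<le> (\<Sum>k<K. cmod (s k))" by (intro sum_mono2) auto
    finally have BK: "(\<Sum>j<n. \<Sum>k<n. cmod (B j k)) \<le> 2 * (\<Sum>k<K. sqrt (cmod (a k)))"
      by (simp add: s1)
    have "frob n (\<lambda>j k. tridiag s j k - B j k) \<le> 2 * (\<Sum>k<n. (cmod (if k < K then 0 else s k))\<^sup>2)"
      unfolding rest frob_def by (rule sum_tridiag_le) auto
    also have "(\<Sum>k<n. (cmod (if k < K then 0 else s k))\<^sup>2) = (\<Sum>k\<in>{K..<n}. cmod (a k))"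
      by (intro sum.mono_neutral_cong_right) (auto simp: s2)
    finally have CK: "frob n (\<lambda>j k. tridiag s j k - B j k) \<le> 2 * (\<Sum>k\<in>{K..<n}. cmod (a k))" .
    have "2 * (\<Sum>\<mu>\<in>#M. if cmod \<mu> \<le> \<delta>\<^sup>2 then cmod \<mu> else 0)
        = (\<Sum>i<n. if (cmod (ev i))\<^sup>2 \<le> \<delta>\<^sup>2 then (cmod (ev i))\<^sup>2 else 0)"
      using transfer[of "\<lambda>\<mu>. if cmod \<mu> \<le> \<delta>\<^sup>2 then cmod \<mu> else 0", unfolded norm_power] by simp
    also have "\<dots> = (\<Sum>i<n. if cmod (ev i) \<le> \<delta> then (cmod (ev i))\<^sup>2 else 0)"
      using \<delta> by (simp add: power_mono_iff)
    also have "\<dots> \<le> \<delta> * (\<Sum>j<n. \<Sum>k<n. cmod (B j k)) + sqrt (frob n (tridiag s)) * sqrt (frob n (\<lambda>j k. tridiag s j k - B j k))"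
      by (rule small[OF \<delta>])
    also have "\<dots> \<le> \<delta> * (2 * (\<Sum>k<K. sqrt (cmod (a k))))
        + sqrt (2 * (\<Sum>k<n. cmod (a k))) * sqrt (2 * (\<Sum>k\<in>{K..<n}. cmod (a k)))"
      by (intro add_mono mult_mono BK \<delta> real_sqrt_le_mono frob CK real_sqrt_ge_zero frob_nonneg)
        (auto intro!: mult_nonneg_nonneg sum_nonneg)
    also have "\<dots> = 2 * (\<delta> * (\<Sum>k<K. sqrt (cmod (a k))) + sqrt (\<Sum>k<n. cmod (a k)) * sqrt (\<Sum>k\<in>{K..<n}. cmod (a k)))"
      by (simp add: real_sqrt_mult algebra_simps)
    finally have "2 * (\<Sum>\<mu>\<in>#M. if cmod \<mu> \<le> \<delta>\<^sup>2 then cmod \<mu> else 0)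
        \<le> 2 * (\<delta> * (\<Sum>k<K. sqrt (cmod (a k)))
          + sqrt (\<Sum>k<n. cmod (a k)) * sqrt (\<Sum>k\<in>{K..<n}. cmod (a k)))" .
    then show "(\<Sum>\<mu>\<in>#M. if cmod \<mu> \<le> \<delta>\<^sup>2 then cmod \<mu> else 0)
       \<le> \<delta> * (\<Sum>k<K. sqrt (cmod (a k))) + sqrt (\<Sum>k<n. cmod (a k)) * sqrt (\<Sum>k\<in>{K..<n}. cmod (a k))"
      by (rule mult_left_le_imp_le) simp
  qed
qed

section \<open>The iterated series as a limit of continuants\<close>

lemma power_Suc_diff_ge:
  fixes A B :: real
  assumes "0 \<le> B" "B \<le> A"
  shows "real (Suc m) * ((A - B) * B ^ m) \<le> A ^ Suc m - B ^ Suc m"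
proof -
  have eq: "A ^ Suc m - B ^ Suc m = (A - B) * (\<Sum>p<Suc m. A ^ p * B ^ (m - p))"
    by (rule diff_power_eq_sum)
  have "(\<Sum>p<Suc m. B ^ m) \<le> (\<Sum>p<Suc m. A ^ p * B ^ (m - p))"
  proof (rule sum_mono)
    fix p assume "p \<in> {..<Suc m}"
    then have "B ^ m = B ^ p * B ^ (m - p)" by (simp flip: power_add)
    also have "\<dots> \<le> A ^ p * B ^ (m - p)"
      using assms by (intro mult_right_mono power_mono) auto
    finally show "B ^ m \<le> A ^ p * B ^ (m - p)" .
  qed
  then have "(A - B) * (\<Sum>p<Suc m. B ^ m) \<le> A ^ Suc m - B ^ Suc m"
    unfolding eq using assms by (intro mult_left_mono) auto
  then show ?thesis by (simp add: algebra_simps)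
qed

text \<open>
  A sequence in the domain of \<open>frakF\<close>, without further restrictions.
\<close>

locale summable_neighbours =
  fixes x :: "nat \<Rightarrow> complex"
  assumes domain: "x \<in> frakF_domain"
begin

text \<open>
  The products of neighbours, written \<open>a\<close> in the introduction.
\<close>

definition nb :: "nat \<Rightarrow> complex" where "nb l = x l * x (Suc l)"

text \<open>
  The tails of the series of their moduli.
\<close>

definition tail :: "nat \<Rightarrow> real" where "tail l = (\<Sum>j. cmod (nb (l + j)))"

lemma summable_nb: "summable (\<lambda>j. cmod (nb (l + j)))"
proof -
  have "summable (\<lambda>k. cmod (nb (k + 1)))"
    using domain by (simp add: frakF_domain_def nb_def)
  then have "summable (\<lambda>k. cmod (nb k))" by (subst (asm) summable_iff_shift)
  then have "summable (\<lambda>k. cmod (nb (k + l)))" by (subst summable_iff_shift)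
  then show ?thesis by (simp add: add.commute)
qed

lemma tail_nonneg: "tail l \<ge> 0"
  unfolding tail_def by (intro suminf_nonneg summable_nb) auto

lemma tail_Suc: "tail l = cmod (nb l) + tail (Suc l)"
  unfolding tail_def using suminf_split_head[OF summable_nb[of l]] by simp

lemma tail_antimono: "tail (Suc l) \<le> tail l"
  using tail_Suc[of l] by simp

lemma tail_tendsto_0: "tail \<longlonglongrightarrow> 0"
proof -
  have "summable (\<lambda>k. norm (cmod (nb k)))" using summable_nb[of 0] by simp
  then have "(\<lambda>n. \<Sum>j. cmod (nb (j + n))) \<longlonglongrightarrow> 0"
    by (intro suminf_exist_split2) simp
  then show ?thesis by (simp add: tail_def[abs_def] add.commute)
qed

lemma tail_telescope:
  "(\<lambda>j. tail (l + j) ^ Suc m - tail (Suc (l + j)) ^ Suc m) sums (tail l ^ Suc m)"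
proof -
  have "(\<lambda>j. tail (j + l)) \<longlonglongrightarrow> 0" by (rule LIMSEQ_ignore_initial_segment[OF tail_tendsto_0])
  then have "(\<lambda>j. tail (l + j) ^ Suc m) \<longlonglongrightarrow> 0 ^ Suc m"
    by (intro tendsto_power) (simp add: add.commute)
  then have "(\<lambda>j. tail (l + j) ^ Suc m - tail (l + Suc j) ^ Suc m) sums (tail (l + 0) ^ Suc m - 0 ^ Suc m)"
    by (rule telescope_sums')
  then show ?thesis by simp
qed

lemma gap_sum_Suc_nb: "gap_sum x (Suc m) l = (\<Sum>j. nb (l + j) * gap_sum x m (l + j + 2))"
  by (simp add: nb_def)

text \<open>
  Since \<open>\<bar>nb l\<bar> = tail l - tail (l + 1)\<close>, a bound of order \<open>m\<close> on the inner series turns into a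
  telescoping bound of order \<open>m + 1\<close>.
\<close>

lemma norm_gap_term_le:
  assumes "\<And>l. cmod (gap_sum x m l) \<le> tail l ^ m / fact m"
  shows "cmod (nb l * gap_sum x m (l + 2)) \<le> (tail l ^ Suc m - tail (Suc l) ^ Suc m) / fact (Suc m)"
proof -
  have "cmod (nb l * gap_sum x m (l + 2)) \<le> cmod (nb l) * (tail (l + 2) ^ m / fact m)"
    unfolding norm_mult by (intro mult_left_mono assms) auto
  also have "\<dots> \<le> cmod (nb l) * (tail (Suc l) ^ m / fact m)"
    using tail_antimono[of "Suc l"] tail_nonneg
    by (intro mult_left_mono divide_right_mono power_mono) auto
  also have "\<dots> = real (Suc m) * ((tail l - tail (Suc l)) * tail (Suc l) ^ m) / fact (Suc m)"
    using tail_Suc[of l] by (simp add: fact_Suc divide_simps del: of_nat_Suc)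
  also have "\<dots> \<le> (tail l ^ Suc m - tail (Suc l) ^ Suc m) / fact (Suc m)"
    by (intro divide_right_mono power_Suc_diff_ge tail_nonneg tail_antimono) auto
  finally show ?thesis .
qed

lemma norm_gap_sum_le: "cmod (gap_sum x m l) \<le> tail l ^ m / fact m"
proof (induction m arbitrary: l)
  case (Suc m)
  define t where "t = (\<lambda>j. (tail (l + j) ^ Suc m - tail (Suc (l + j)) ^ Suc m) / fact (Suc m))"
  have t: "t sums (tail l ^ Suc m / fact (Suc m))"
    unfolding t_def by (intro sums_divide tail_telescope)
  have le: "cmod (nb (l + j) * gap_sum x m (l + j + 2)) \<le> t j" for j
    unfolding t_def using norm_gap_term_le[OF Suc, of "l + j"] by simp
  have "cmod (gap_sum x (Suc m) l) \<le> (\<Sum>j. t j)"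
    unfolding gap_sum_Suc_nb by (rule norm_suminf_le[OF le sums_summable[OF t]])
  then show ?case using t by (simp add: sums_iff)
qed simp

lemma summable_gap_terms: "summable (\<lambda>j. nb (l + j) * gap_sum x m (l + j + 2))"
proof (rule summable_comparison_test')
  show "summable (\<lambda>j. (tail (l + j) ^ Suc m - tail (Suc (l + j)) ^ Suc m) / fact (Suc m))"
    using sums_divide[OF tail_telescope] by (rule sums_summable)
  show "cmod (nb (l + j) * gap_sum x m (l + j + 2))
      \<le> (tail (l + j) ^ Suc m - tail (Suc (l + j)) ^ Suc m) / fact (Suc m)" if "j \<ge> 0" for j
    using norm_gap_term_le[OF norm_gap_sum_le, of "l + j"] by simp
qed

lemma gap_sum_rec: "gap_sum x (Suc m) l = gap_sum x (Suc m) (Suc l) + nb l * gap_sum x m (l + 2)"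
  unfolding gap_sum_Suc_nb using suminf_split_head[OF summable_gap_terms[of l m]] by simp

text \<open>
  The series that defines \<open>frakF\<close>, as a function of \<open>z = w\<^sup>2\<close>, with indices starting at \<open>l\<close>.
\<close>

definition char_series :: "complex \<Rightarrow> nat \<Rightarrow> complex" where
  "char_series z l = (\<Sum>m. (- z) ^ m * gap_sum x m l)"

lemma norm_char_term_le: "cmod ((- z) ^ m * gap_sum x m l) \<le> (cmod z * tail l) ^ m / fact m"
  using mult_left_mono[OF norm_gap_sum_le[of m l], of "cmod z ^ m"]
  by (simp add: norm_mult norm_power power_mult_distrib)

lemma exp_sums: "(\<lambda>m. t ^ m / fact m) sums exp (t :: real)"
  using exp_converges[of t] by (simp add: divide_inverse mult.commute)

lemma summable_char_terms: "summable (\<lambda>m. (- z) ^ m * gap_sum x m l)"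
  by (rule summable_comparison_test'[OF sums_summable[OF exp_sums] norm_char_term_le])

lemma char_series_head:
  "char_series z l = 1 + (\<Sum>m. (- z) ^ Suc m * gap_sum x (Suc m) l)"
  unfolding char_series_def using suminf_split_head[OF summable_char_terms[of z l]] by simp

lemma char_series_rec:
  "char_series z l = char_series z (Suc l) - z * nb l * char_series z (l + 2)"
proof -
  have s1: "summable (\<lambda>m. (- z) ^ Suc m * gap_sum x (Suc m) (Suc l))"
    using summable_char_terms[of z "Suc l"] by (subst summable_Suc_iff)
  have s2: "summable (\<lambda>m. - z * nb l * ((- z) ^ m * gap_sum x m (l + 2)))"
    by (intro summable_mult summable_char_terms)
  have "char_series z l = 1 + (\<Sum>m. (- z) ^ Suc m * gap_sum x (Suc m) (Suc l)
      + - z * nb l * ((- z) ^ m * gap_sum x m (l + 2)))"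
    unfolding char_series_head gap_sum_rec[of _ l]
    by (simp add: algebra_simps del: gap_sum.simps)
  also have "\<dots> = char_series z (Suc l) + - z * nb l * char_series z (l + 2)"
    unfolding suminf_add[OF s1 s2, symmetric] suminf_mult[OF summable_char_terms]
      char_series_head[of z "Suc l"] char_series_def[of z "l + 2"] by simp
  finally show ?thesis by simp
qed

lemma char_series_tendsto_1: "char_series z \<longlonglongrightarrow> 1"
proof -
  have le: "cmod (char_series z l - 1) \<le> exp (cmod z * tail l) - 1" for l
  proof -
    have s: "(\<lambda>m. (cmod z * tail l) ^ Suc m / fact (Suc m)) sums (exp (cmod z * tail l) - 1)"
      using exp_sums[of "cmod z * tail l"] by (subst sums_Suc_iff) simp
    have "cmod (\<Sum>m. (- z) ^ Suc m * gap_sum x (Suc m) l)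
        \<le> (\<Sum>m. (cmod z * tail l) ^ Suc m / fact (Suc m))"
      by (rule norm_suminf_le[OF norm_char_term_le sums_summable[OF s]])
    then show ?thesis using s by (simp add: char_series_head sums_iff)
  qed
  have "(\<lambda>l. exp (cmod z * tail l) - 1) \<longlonglongrightarrow> exp (cmod z * 0) - 1"
    by (intro tendsto_intros tail_tendsto_0)
  then have lim: "(\<lambda>l. exp (cmod z * tail l) - 1) \<longlonglongrightarrow> 0" by simp
  have "\<forall>\<^sub>F l in sequentially. cmod (char_series z l - 1) \<le> exp (cmod z * tail l) - 1"
    using le by simp
  then have "(\<lambda>l. char_series z l - 1) \<longlonglongrightarrow> 0"
    using lim by (rule Lim_null_comparison)
  then show ?thesis by (rule LIM_zero_cancel)
qed

lemma gap_sum_scale: "gap_sum (\<lambda>k. w * x k) m l = (w\<^sup>2) ^ m * gap_sum x m l"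
proof (induction m arbitrary: l)
  case (Suc m)
  have "gap_sum (\<lambda>k. w * x k) (Suc m) l = (\<Sum>j. (w\<^sup>2) ^ Suc m * (nb (l + j) * gap_sum x m (l + j + 2)))"
    by (simp add: Suc nb_def power2_eq_square mult_ac)
  also have "\<dots> = (w\<^sup>2) ^ Suc m * gap_sum x (Suc m) l"
    unfolding gap_sum_Suc_nb by (rule suminf_mult[OF summable_gap_terms])
  finally show ?case .
qed simp

lemma frakF_eq_char_series: "frakF (\<lambda>k. w * x k) = char_series (w\<^sup>2) 1"
proof -
  have "(- 1) ^ Suc m * ((w\<^sup>2) ^ Suc m * c) = (- (w\<^sup>2)) ^ Suc m * c" for m c
    by (subst power_minus) (simp add: mult.assoc)
  then show ?thesis
    unfolding frakF_def char_series_head gap_sum_scale by (simp only: Suc_eq_plus1)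
qed

text \<open>
  The characteristic series and the continuant satisfy the same recursion in \<open>l\<close>, which
  propagates the error \<open>\<epsilon>\<close> made at the far end, where the series is replaced by 1.
\<close>

lemma char_series_minus_continuant:
  assumes "\<And>j. l + n \<le> Suc j \<Longrightarrow> cmod (char_series z j - 1) \<le> \<epsilon>"
  shows "cmod (char_series z l - poly (continuant (\<lambda>k. nb (l + k)) n) z)
    \<le> \<epsilon> * (\<Prod>k<n. 1 + cmod (z * nb (l + k)))"
  using assms
proof (induction n arbitrary: l rule: induct_nat_012)
  case 0
  then show ?case by simp
next
  case 1
  have "cmod (char_series z l - 1) \<le> \<epsilon>" by (rule 1) simp
  moreover from this have "0 \<le> \<epsilon>" by (rule order_trans[OF norm_ge_zero])
  ultimately have "cmod (char_series z l - 1) * 1 \<le> \<epsilon> * (1 + cmod (z * nb l))"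
    by (intro mult_mono) auto
  then show ?case by simp
next
  case (ge2 n)
  define q1 where "q1 = poly (continuant (\<lambda>k. nb (Suc l + k)) (Suc n)) z"
  define q2 where "q2 = poly (continuant (\<lambda>k. nb (l + 2 + k)) n) z"
  define p where "p = (\<Prod>k<Suc n. 1 + cmod (z * nb (Suc l + k)))"
  have h1: "cmod (char_series z (Suc l) - q1) \<le> \<epsilon> * p"
    unfolding q1_def p_def by (rule ge2.IH(2)) (rule ge2.prems, simp)
  have h2: "cmod (char_series z (l + 2) - q2) \<le> \<epsilon> * (\<Prod>k<n. 1 + cmod (z * nb (l + 2 + k)))"
    unfolding q2_def by (rule ge2.IH(1)) (rule ge2.prems, simp)
  have "0 \<le> cmod (char_series z (Suc l + n) - 1)" by simp
  also have "\<dots> \<le> \<epsilon>" by (rule ge2.prems) simp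
  finally have \<epsilon>: "0 \<le> \<epsilon>" .
  have "1 * (\<Prod>k<n. 1 + cmod (z * nb (l + 2 + k))) \<le> p"
    unfolding p_def prod.lessThan_Suc_shift
    by (intro mult_mono) (auto intro!: prod_nonneg add_nonneg_nonneg)
  then have "\<epsilon> * (\<Prod>k<n. 1 + cmod (z * nb (l + 2 + k))) \<le> \<epsilon> * p"
    using \<epsilon> by (intro mult_left_mono) auto
  with h2 have h2': "cmod (char_series z (l + 2) - q2) \<le> \<epsilon> * p" by (rule order_trans)
  have "char_series z l - poly (continuant (\<lambda>k. nb (l + k)) (Suc (Suc n))) z
      = (char_series z (Suc l) - q1) - z * nb l * (char_series z (l + 2) - q2)"
    unfolding char_series_rec[of z l] by (simp add: q1_def q2_def algebra_simps)
  also have "cmod \<dots> \<le> cmod (char_series z (Suc l) - q1) + cmod (z * nb l) * cmod (char_series z (l + 2) - q2)"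
    unfolding norm_mult[of "z * nb l", symmetric] by (rule norm_triangle_ineq4)
  also have "\<dots> \<le> \<epsilon> * p + cmod (z * nb l) * (\<epsilon> * p)"
    by (intro add_mono mult_left_mono h1 h2') auto
  also have "\<dots> = \<epsilon> * ((1 + cmod (z * nb l)) * p)" by (simp add: algebra_simps)
  also have "(1 + cmod (z * nb l)) * p = (\<Prod>k<Suc (Suc n). 1 + cmod (z * nb (l + k)))"
    unfolding prod.lessThan_Suc_shift[of _ "Suc n"] p_def by simp
  finally show ?case .
qed

lemma continuant_tendsto_char_series:
  "(\<lambda>n. poly (continuant (\<lambda>k. nb (l + k)) n) z) \<longlonglongrightarrow> char_series z l"
proof (rule metric_LIMSEQ_I)
  fix r :: real assume r: "r > 0"
  define C where "C = exp (cmod z * tail l)"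
  have C: "C > 0" by (simp add: C_def)
  have prod_le: "(\<Prod>k<n. 1 + cmod (z * nb (l + k))) \<le> C" for n
  proof -
    have "(\<Prod>k<n. 1 + cmod (z * nb (l + k))) \<le> (\<Prod>k<n. exp (cmod (z * nb (l + k))))"
      by (intro prod_mono) (auto simp: exp_ge_add_one_self)
    also have "\<dots> = exp (cmod z * (\<Sum>k<n. cmod (nb (l + k))))"
      by (simp add: exp_sum norm_mult sum_distrib_left)
    also have "\<dots> \<le> C"
      unfolding C_def tail_def exp_le_cancel_iff
      by (intro mult_left_mono sum_le_suminf summable_nb) auto
    finally show ?thesis .
  qed
  from metric_LIMSEQ_D[OF char_series_tendsto_1, of "r / (2 * C)" z] r C
  obtain N where N: "\<And>j. j \<ge> N \<Longrightarrow> dist (char_series z j) 1 < r / (2 * C)" by auto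
  show "\<exists>no. \<forall>n\<ge>no. dist (poly (continuant (\<lambda>k. nb (l + k)) n) z) (char_series z l) < r"
  proof (intro exI allI impI)
    fix n assume n: "n \<ge> Suc N"
    have "cmod (char_series z l - poly (continuant (\<lambda>k. nb (l + k)) n) z)
        \<le> r / (2 * C) * (\<Prod>k<n. 1 + cmod (z * nb (l + k)))"
      using N n by (intro char_series_minus_continuant less_imp_le) (auto simp: dist_norm)
    also have "\<dots> \<le> r / (2 * C) * C"
      using r C by (intro mult_left_mono prod_le) auto
    also have "\<dots> < r" using r C by simp
    finally show "dist (poly (continuant (\<lambda>k. nb (l + k)) n) z) (char_series z l) < r"
      by (simp add: dist_norm norm_minus_commute)
  qed
qed

end

section \<open>Limits of products with uniformly small tails\<close>

lemma norm_prod_one_minus_diff_le: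
  fixes u :: "nat \<Rightarrow> complex"
  assumes tot: "(\<Sum>k<N. cmod (u k)) \<le> S" and tail: "(\<Sum>k\<in>{K..<N}. cmod (u k)) \<le> \<eta>" and KN: "K \<le> N"
  shows "cmod ((\<Prod>k<N. 1 - z * u k) - (\<Prod>k<K. 1 - z * u k)) \<le> exp (cmod z * S) * (exp (cmod z * \<eta>) - 1)"
proof -
  have prod_le: "(\<Prod>k\<in>I. 1 + cmod (z * u k)) \<le> exp (cmod z * s)"
    if "(\<Sum>k\<in>I. cmod (u k)) \<le> s" "finite I" for I s
  proof -
    have "(\<Prod>k\<in>I. 1 + cmod (z * u k)) \<le> (\<Prod>k\<in>I. exp (cmod (z * u k)))"
      by (intro prod_mono) (auto simp: exp_ge_add_one_self)
    also have "\<dots> = exp (cmod z * (\<Sum>k\<in>I. cmod (u k)))"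
      using that by (simp add: exp_sum norm_mult sum_distrib_left)
    also have "\<dots> \<le> exp (cmod z * s)"
      unfolding exp_le_cancel_iff using that by (intro mult_left_mono) auto
    finally show ?thesis .
  qed
  have "(\<Sum>k<K. cmod (u k)) \<le> (\<Sum>k<N. cmod (u k))"
    using KN by (intro sum_mono2) auto
  then have totK: "(\<Sum>k<K. cmod (u k)) \<le> S" using tot by simp
  have "cmod (\<Prod>k<K. 1 - z * u k) \<le> (\<Prod>k<K. 1 + cmod (z * u k))"
    unfolding prod_norm[symmetric]
    by (intro prod_mono conjI norm_ge_zero order_trans[OF norm_triangle_ineq4]) simp
  also have "\<dots> \<le> exp (cmod z * S)" by (rule prod_le[OF totK]) simp
  finally have 1: "cmod (\<Prod>k<K. 1 - z * u k) \<le> exp (cmod z * S)" .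
  have "cmod ((\<Prod>k\<in>{K..<N}. 1 + - (z * u k)) - 1) \<le> (\<Prod>k\<in>{K..<N}. 1 + cmod (- (z * u k))) - 1"
    by (rule norm_prod_minus1_le_prod_minus1)
  also have "\<dots> \<le> exp (cmod z * \<eta>) - 1"
    using prod_le[OF tail] by simp
  finally have 2: "cmod ((\<Prod>k\<in>{K..<N}. 1 - z * u k) - 1) \<le> exp (cmod z * \<eta>) - 1" by simp
  have "(\<Prod>k<N. 1 - z * u k) = (\<Prod>k<K. 1 - z * u k) * (\<Prod>k\<in>{K..<N}. 1 - z * u k)"
  proof -
    have "{..<N} = {..<K} \<union> {K..<N}" using KN by auto
    then show ?thesis by (simp add: prod.union_disjoint ivl_disj_int)
  qed
  then have "(\<Prod>k<N. 1 - z * u k) - (\<Prod>k<K. 1 - z * u k)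
      = (\<Prod>k<K. 1 - z * u k) * ((\<Prod>k\<in>{K..<N}. 1 - z * u k) - 1)"
    by (simp add: algebra_simps)
  then show ?thesis
    unfolding norm_mult using 1 2 by (auto simp: norm_mult intro!: mult_mono)
qed

text \<open>
  The \<open>n\<close>-th row of \<open>m\<close> holds the reciprocals of the zeros of \<open>p n\<close>, padded with zeros. The hypothesis
  \<open>small\<close> prevents many small numbers from producing an exponential factor in the limit \<open>g\<close>.
\<close>

lemma product_limit:
  fixes m :: "nat \<Rightarrow> nat \<Rightarrow> complex" and p :: "nat \<Rightarrow> complex \<Rightarrow> complex"
  assumes dec: "\<And>n k. cmod (m n (Suc k)) \<le> cmod (m n k)"
    and tot: "\<And>n N. (\<Sum>k<N. cmod (m n k)) \<le> S"
    and small: "\<And>\<eta>. \<eta> > 0 \<Longrightarrow>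
      \<exists>\<epsilon>>0. \<forall>n N. (\<Sum>k<N. if cmod (m n k) \<le> \<epsilon> then cmod (m n k) else 0) \<le> \<eta>"
    and prod: "\<And>n. \<exists>L. \<forall>N\<ge>L. \<forall>z. (\<Prod>k<N. 1 - z * m n k) = p n z"
    and lim: "\<And>z. (\<lambda>n. p n z) \<longlonglongrightarrow> g z"
  obtains \<mu> where "\<And>k. cmod (\<mu> (Suc k)) \<le> cmod (\<mu> k)" "summable (\<lambda>k. cmod (\<mu> k))"
    "\<And>z. (\<lambda>N. \<Prod>k<N. 1 - z * \<mu> k) \<longlonglongrightarrow> g z"
proof -
  have S0: "S \<ge> 0" using tot[of 0 0] by simp
  \<comment> \<open>The first \<open>k + 1\<close> terms of a row all have modulus at least that of the last of them.\<close>
  have decay: "real (Suc k) * cmod (m n k) \<le> S" for n k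
  proof -
    have "antimono (\<lambda>k. cmod (m n k))" by (intro antimono_iff_le_Suc[THEN iffD2] allI dec)
    then have "cmod (m n k) \<le> cmod (m n j)" if "j < Suc k" for j
      using that by (intro antimonoD[of "\<lambda>k. cmod (m n k)" j k]) auto
    then have "(\<Sum>j<Suc k. cmod (m n k)) \<le> (\<Sum>j<Suc k. cmod (m n j))"
      by (intro sum_mono) simp
    also have "\<dots> \<le> S" by (rule tot)
    finally show ?thesis by simp
  qed
  have bd: "cmod (m n k) \<le> S" for n k
    using member_le_sum[of k "{..<Suc k}" "\<lambda>k. cmod (m n k)"] tot[of n "Suc k"] by simp
  obtain s where s: "strict_mono s" "\<And>k. k \<in> UNIV \<Longrightarrow> \<exists>l. (\<lambda>n. m (s n) k) \<longlonglongrightarrow> l"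
    by (rule function_convergent_subsequence[of "UNIV :: nat set" m S, OF _ bd]) auto
  then obtain \<mu> where \<mu>: "\<And>k. (\<lambda>n. m (s n) k) \<longlonglongrightarrow> \<mu> k" by (metis (no_types) UNIV_I)
  have dec\<mu>: "cmod (\<mu> (Suc k)) \<le> cmod (\<mu> k)" for k
    by (rule LIMSEQ_le[OF tendsto_norm[OF \<mu>] tendsto_norm[OF \<mu>]]) (simp add: dec)
  have tot\<mu>: "(\<Sum>k<N. cmod (\<mu> k)) \<le> S" for N
    by (rule LIMSEQ_le_const2[OF tendsto_sum[OF tendsto_norm[OF \<mu>]]]) (simp add: tot)
  have summable: "summable (\<lambda>k. cmod (\<mu> k))"
  proof (rule bounded_imp_summable)
    fix n show "(\<Sum>k\<le>n. cmod (\<mu> k)) \<le> S"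
      using tot\<mu>[of "Suc n"] by (simp only: lessThan_Suc_atMost)
  qed simp
  have "(\<lambda>N. \<Prod>k<N. 1 - z * \<mu> k) \<longlonglongrightarrow> g z" for z
  proof -
    \<comment> \<open>From \<open>K0\<close> on all terms of all rows have modulus at most \<open>\<epsilon>\<close>, so that \<open>small\<close> bounds their
    tails.\<close>
    have key: "\<exists>K0. \<forall>K\<ge>K0. cmod (g z - (\<Prod>k<K. 1 - z * \<mu> k)) \<le> exp (cmod z * S) * (exp (cmod z * \<eta>) - 1)"
      if \<eta>: "\<eta> > 0" for \<eta>
    proof -
      obtain \<epsilon> where \<epsilon>: "\<epsilon> > 0"
        "\<And>n N. (\<Sum>k<N. if cmod (m n k) \<le> \<epsilon> then cmod (m n k) else 0) \<le> \<eta>"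
        using small[OF \<eta>] by blast
      obtain K0 :: nat where K0: "S / \<epsilon> < real K0" using reals_Archimedean2 by blast
      have le: "cmod (m n k) \<le> \<epsilon>" if "k \<ge> K0" for n k
      proof -
        have "S < real K0 * \<epsilon>" using K0 \<epsilon>(1) by (simp add: field_simps)
        also have "\<dots> \<le> real (Suc k) * \<epsilon>" using that \<epsilon>(1) by (intro mult_right_mono) auto
        finally have "real (Suc k) * cmod (m n k) < real (Suc k) * \<epsilon>"
          using decay[of k n] by linarith
        then show ?thesis by simp
      qed
      have bound: "cmod (p n z - (\<Prod>k<K. 1 - z * m n k)) \<le> exp (cmod z * S) * (exp (cmod z * \<eta>) - 1)"
        if K: "K \<ge> K0" for n K
      proof -
        obtain L where L: "\<And>N z. N \<ge> L \<Longrightarrow> (\<Prod>k<N. 1 - z * m n k) = p n z" using prod by blast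
        define N where "N = max K L"
        have "(\<Sum>k\<in>{K..<N}. cmod (m n k)) = (\<Sum>k\<in>{K..<N}. if cmod (m n k) \<le> \<epsilon> then cmod (m n k) else 0)"
          using K le by (intro sum.cong) auto
        also have "\<dots> \<le> (\<Sum>k<N. if cmod (m n k) \<le> \<epsilon> then cmod (m n k) else 0)"
          by (intro sum_mono2) auto
        also have "\<dots> \<le> \<eta>" by (rule \<epsilon>(2))
        finally have "cmod ((\<Prod>k<N. 1 - z * m n k) - (\<Prod>k<K. 1 - z * m n k))
            \<le> exp (cmod z * S) * (exp (cmod z * \<eta>) - 1)"
          by (intro norm_prod_one_minus_diff_le tot) (simp_all add: N_def)
        then show ?thesis using L[of N z] by (simp add: N_def)
      qed
      show ?thesis
      proof (intro exI allI impI)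
        fix K assume K: "K \<ge> K0"
        have "(\<lambda>n. p (s n) z) \<longlonglongrightarrow> g z"
          using LIMSEQ_subseq_LIMSEQ[OF lim s(1)] by (simp add: o_def)
        moreover have "(\<lambda>n. \<Prod>k<K. 1 - z * m (s n) k) \<longlonglongrightarrow> (\<Prod>k<K. 1 - z * \<mu> k)"
          by (intro tendsto_prod tendsto_intros \<mu>)
        ultimately have "(\<lambda>n. cmod (p (s n) z - (\<Prod>k<K. 1 - z * m (s n) k)))
            \<longlonglongrightarrow> cmod (g z - (\<Prod>k<K. 1 - z * \<mu> k))"
          by (intro tendsto_norm tendsto_diff)
        then show "cmod (g z - (\<Prod>k<K. 1 - z * \<mu> k)) \<le> exp (cmod z * S) * (exp (cmod z * \<eta>) - 1)"
          by (rule LIMSEQ_le_const2) (use bound[OF K] in auto)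
      qed
    qed
    show ?thesis
    proof (rule metric_LIMSEQ_I)
      fix r :: real assume r: "r > 0"
      have "((\<lambda>\<eta>. exp (cmod z * S) * (exp (cmod z * \<eta>) - 1)) \<longlongrightarrow> exp (cmod z * S) * (exp (cmod z * 0) - 1)) (at_right 0)"
        by (intro tendsto_intros)
      then have "\<forall>\<^sub>F \<eta> in at_right 0. exp (cmod z * S) * (exp (cmod z * \<eta>) - 1) < r"
        using r by (intro order_tendstoD(2)) auto
      then have "\<forall>\<^sub>F \<eta> in at_right 0. exp (cmod z * S) * (exp (cmod z * \<eta>) - 1) < r \<and> \<eta> > 0"
        using eventually_at_right_less by (rule eventually_conj)
      then obtain \<eta> where \<eta>: "exp (cmod z * S) * (exp (cmod z * \<eta>) - 1) < r" "\<eta> > 0"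
        using eventually_happens trivial_limit_at_right_real by blast
      from key[OF \<eta>(2)] obtain K0 where
        "\<And>K. K \<ge> K0 \<Longrightarrow> cmod (g z - (\<Prod>k<K. 1 - z * \<mu> k)) \<le> exp (cmod z * S) * (exp (cmod z * \<eta>) - 1)"
        by blast
      with \<eta>(1) show "\<exists>no. \<forall>N\<ge>no. dist (\<Prod>k<N. 1 - z * \<mu> k) (g z) < r"
        by (intro exI[of _ K0]) (force simp: dist_norm norm_minus_commute)
    qed
  qed
  with that dec\<mu> summable show ?thesis by blast
qed

text \<open>
  A finite multiset as a sequence of decreasing modulus that ends in zeros.
\<close>

lemma sorted_enumeration:
  fixes M :: "complex multiset"
  obtains m :: "nat \<Rightarrow> complex" where
    "\<And>k. cmod (m (Suc k)) \<le> cmod (m k)"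
    "\<exists>L. \<forall>N\<ge>L. \<forall>z. (\<Prod>k<N. 1 - z * m k) = (\<Prod>\<mu>\<in>#M. 1 - z * \<mu>)"
    "\<And>(h :: complex \<Rightarrow> real) N. (\<And>\<mu>. h \<mu> \<ge> 0) \<Longrightarrow> h 0 = 0 \<Longrightarrow> (\<Sum>k<N. h (m k)) \<le> (\<Sum>\<mu>\<in>#M. h \<mu>)"
proof -
  obtain ys where ys: "mset ys = M" using ex_mset by blast
  define xs where "xs = sort_key (\<lambda>\<mu>. - cmod \<mu>) ys"
  have xs: "mset xs = M" by (simp add: xs_def ys)
  define m where "m = (\<lambda>k. if k < length xs then xs ! k else 0)"
  show ?thesis
  proof (rule that[of m])
    fix k
    have "sorted (map (\<lambda>\<mu>. - cmod \<mu>) xs)" by (simp add: xs_def)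
    then show "cmod (m (Suc k)) \<le> cmod (m k)"
      by (auto simp: m_def sorted_iff_nth_Suc)
  next
    show "\<exists>L. \<forall>N\<ge>L. \<forall>z. (\<Prod>k<N. 1 - z * m k) = (\<Prod>\<mu>\<in>#M. 1 - z * \<mu>)"
    proof (intro exI allI impI)
      fix N z assume N: "N \<ge> length xs"
      have "(\<Prod>k<N. 1 - z * m k) = (\<Prod>k<length xs. 1 - z * xs ! k)"
        using N by (intro prod.mono_neutral_cong_right) (auto simp: m_def)
      also have "\<dots> = (\<Prod>\<mu>\<leftarrow>xs. 1 - z * \<mu>)"
        by (simp add: prod.list_conv_set_nth atLeast0LessThan)
      also have "\<dots> = (\<Prod>\<mu>\<in>#M. 1 - z * \<mu>)"
        by (simp flip: xs mset_map prod_mset_prod_list)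
      finally show "(\<Prod>k<N. 1 - z * m k) = (\<Prod>\<mu>\<in>#M. 1 - z * \<mu>)" .
    qed
  next
    fix h :: "complex \<Rightarrow> real" and N
    assume h: "\<And>\<mu>. h \<mu> \<ge> 0" "h 0 = 0"
    have "(\<Sum>k<N. h (m k)) \<le> (\<Sum>k<max N (length xs). h (m k))"
      using h by (intro sum_mono2) auto
    also have "\<dots> = (\<Sum>k<length xs. h (xs ! k))"
      using h by (intro sum.mono_neutral_cong_right) (auto simp: m_def)
    also have "\<dots> = (\<Sum>\<mu>\<leftarrow>xs. h \<mu>)"
      by (simp add: sum.list_conv_set_nth atLeast0LessThan)
    also have "\<dots> = (\<Sum>\<mu>\<in>#M. h \<mu>)"
      by (simp flip: xs mset_map sum_mset_sum_list)
    finally show "(\<Sum>k<N. h (m k)) \<le> (\<Sum>\<mu>\<in>#M. h \<mu>)" .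
  qed
qed

section \<open>Zeros of canonical products\<close>

lemma zorder_one_minus_mult:
  assumes "\<mu> \<noteq> 0"
  shows "zorder (\<lambda>z. 1 - z * \<mu>) z0 = of_bool (z0 * \<mu> = 1)"
proof (cases "z0 * \<mu> = 1")
  case True
  then have z0: "z0 = 1 / \<mu>" using assms by (simp add: field_simps)
  have "zorder (\<lambda>z. 1 - z * \<mu>) z0 = 1"
    by (rule zorder_eqI[of UNIV _ "\<lambda>_. - \<mu>"]) (use assms in \<open>auto simp: z0 field_simps\<close>)
  with True show ?thesis by simp
next
  case False
  then show ?thesis
    by (subst zorder_eq_0I) (auto intro!: analytic_intros)
qed

lemma finite_product_zorder:
  fixes \<mu> :: "nat \<Rightarrow> complex"
  assumes "finite J" "\<And>k. k \<in> J \<Longrightarrow> \<mu> k \<noteq> 0"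
  shows "zorder (\<lambda>z. \<Prod>k\<in>J. 1 - z * \<mu> k) z0 = int (card {k\<in>J. z0 * \<mu> k = 1})"
proof -
  have "\<forall>\<^sub>F z in at z0. \<forall>k\<in>J. 1 - z * \<mu> k \<noteq> 0"
  proof (intro eventually_ball_finite ballI assms(1))
    fix k assume "k \<in> J"
    then have "1 - z * \<mu> k \<noteq> 0" if "z \<noteq> 1 / \<mu> k" for z
      using that assms(2) by (auto simp: field_simps)
    moreover have "\<forall>\<^sub>F z in at z0. z \<noteq> 1 / \<mu> k" by (rule eventually_neq_at_within)
    ultimately show "\<forall>\<^sub>F z in at z0. 1 - z * \<mu> k \<noteq> 0" by (auto elim: eventually_mono)
  qed
  then have "\<forall>\<^sub>F z in at z0. (\<Prod>k\<in>J. 1 - z * \<mu> k) \<noteq> 0"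
    by (rule eventually_mono) (simp add: assms(1))
  then have "zorder (\<lambda>z. \<Prod>k\<in>J. 1 - z * \<mu> k) z0 = (\<Sum>k\<in>J. zorder (\<lambda>z. 1 - z * \<mu> k) z0)"
    by (intro zorder_prod_analytic analytic_intros)
  also have "\<dots> = (\<Sum>k\<in>J. if z0 * \<mu> k = 1 then 1 else 0)"
    by (intro sum.cong refl) (simp add: zorder_one_minus_mult assms(2))
  also have "\<dots> = int (card {k\<in>J. z0 * \<mu> k = 1})"
    using assms(1) by (simp add: sum.If_cases Int_def)
  finally show ?thesis .
qed

text \<open>
  This is the Weierstrass product of genus 0 with zeros \<open>1 / \<mu> k\<close>.
\<close>

lemma infinite_product_zeros:
  fixes \<mu> :: "nat \<Rightarrow> complex"
  assumes nz: "\<And>k. \<mu> k \<noteq> 0" and summable: "summable (\<lambda>k. cmod (\<mu> k))"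
    and lim: "\<And>z. (\<lambda>N. \<Prod>k<N. 1 - z * \<mu> k) \<longlonglongrightarrow> g z"
  shows "g holomorphic_on UNIV" "(\<lambda>k. 1 - z * \<mu> k) has_prod g z"
    "g z = 0 \<longleftrightarrow> (\<exists>k. z * \<mu> k = 1)" "finite {k. z * \<mu> k = 1}"
    "zorder g z = int (card {k. z * \<mu> k = 1})"
proof -
  interpret W: weierstrass_product "\<lambda>k. 1 / \<mu> k" "\<lambda>_. 0"
  proof
    show "1 / \<mu> n \<noteq> 0" for n using nz by simp
    have "(\<lambda>k. cmod (\<mu> k)) \<longlonglongrightarrow> 0" by (rule summable_LIMSEQ_zero[OF summable])
    then have "\<mu> \<longlonglongrightarrow> 0" by (rule tendsto_norm_zero_cancel)
    then have "filterlim \<mu> (at 0) sequentially" by (rule filterlim_atI) (simp add: nz)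
    then show "filterlim (\<lambda>k. 1 / \<mu> k) at_infinity sequentially"
      unfolding divide_inverse mult_1 by (rule filterlim_compose[OF filterlim_inverse_at_infinity])
    show "summable (\<lambda>n. (r / cmod (1 / \<mu> n)) ^ Suc 0)" for r
      using summable_mult[OF summable, of r] by (simp add: norm_divide)
  qed
  have factor: "weierstrass_factor 0 (z / (1 / \<mu> k)) = 1 - z * \<mu> k" for z k
    by (simp add: weierstrass_factor_def)
  have prod: "(\<lambda>k. 1 - z * \<mu> k) has_prod W.f z" for z
    using W.has_prod[of z] unfolding factor .
  have g: "g = W.f"
  proof
    fix z
    have "(\<lambda>N. \<Prod>k\<le>N. 1 - z * \<mu> k) \<longlonglongrightarrow> W.f z"
      using prod[of z] by (metis convergent_prod_LIMSEQ has_prod_iff)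
    then have "(\<lambda>N. \<Prod>k<N. 1 - z * \<mu> k) \<longlonglongrightarrow> W.f z"
      by (simp add: LIMSEQ_lessThan_iff_atMost)
    with lim show "g z = W.f z" by (rule LIMSEQ_unique)
  qed
  have set: "(\<lambda>k. 1 / \<mu> k) -` {z} = {k. z * \<mu> k = 1}" for z
    using nz by (auto simp: field_simps)
  show "g holomorphic_on UNIV" unfolding g by (rule W.holomorphic)
  show "(\<lambda>k. 1 - z * \<mu> k) has_prod g z" unfolding g by (rule prod)
  show "g z = 0 \<longleftrightarrow> (\<exists>k. z * \<mu> k = 1)"
    using W.zero[of z] set[of z] unfolding g by auto
  show "finite {k. z * \<mu> k = 1}" using W.finite_occs_a[of z] unfolding set .
  show "zorder g z = int (card {k. z * \<mu> k = 1})" using W.zorder[of z] unfolding set g .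
qed

lemma zorder_compose_square:
  assumes holo: "g holomorphic_on UNIV" and g0: "g 0 \<noteq> 0" and w: "w \<noteq> (0 :: complex)"
  shows "zorder (\<lambda>w. g (w\<^sup>2)) w = zorder g (w\<^sup>2)"
proof -
  have an: "g analytic_on {w\<^sup>2}"
    using holo analytic_on_open[of UNIV g] analytic_on_subset[of g UNIV "{w\<^sup>2}"] by simp
  have sq: "zorder (\<lambda>x. x\<^sup>2 - w\<^sup>2) w = 1"
    by (rule zorder_eqI[of UNIV _ "\<lambda>x. x + w"])
      (use w in \<open>auto intro!: holomorphic_intros simp: power2_eq_square algebra_simps\<close>)
  have "zorder (g \<circ> (\<lambda>w. w\<^sup>2)) w = zorder g (w\<^sup>2) * zorder (\<lambda>x. x\<^sup>2 - w\<^sup>2) w"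
  proof (rule zorder_compose')
    show "isolated_singularity_at g (w\<^sup>2)" by (rule isolated_singularity_at_analytic[OF an])
    show "not_essential g (w\<^sup>2)" by (rule not_essential_analytic[OF an])
    show "(\<lambda>w. w\<^sup>2) analytic_on {w}" by (intro analytic_intros)
    have "\<forall>\<^sub>F u in at (w\<^sup>2). g u \<noteq> 0 \<and> u \<in> UNIV"
      by (rule non_zero_neighbour_alt[OF holo _ _ _ _ g0]) auto
    then show "\<forall>\<^sub>F u in at (w\<^sup>2). g u \<noteq> 0" by simp
    have "\<forall>\<^sub>F u in at w. u \<noteq> w \<and> u \<noteq> - w"
      by (intro eventually_conj eventually_neq_at_within)
    then show "\<forall>\<^sub>F u in at w. u\<^sup>2 \<noteq> w\<^sup>2" by (rule eventually_mono) (simp add: power2_eq_iff)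
  qed
  then show ?thesis by (simp add: o_def sq)
qed

text \<open>
  At a nonzero point \<open>w\<close> squaring is locally injective, so \<open>g (w\<^sup>2)\<close> has a zero of the same order
  at \<open>w\<close> as \<open>g\<close> at \<open>w\<^sup>2\<close>. The root \<open>w\<close> of \<open>w\<^sup>2\<close> is \<open>\<zeta> k\<close> or \<open>- \<zeta> k\<close>, but never both.
\<close>

lemma lists_zeros_square:
  fixes \<zeta> :: "'i \<Rightarrow> complex"
  assumes holo: "g holomorphic_on UNIV" and g0: "g 0 \<noteq> 0"
    and zero: "\<And>k. k \<in> I \<Longrightarrow> g ((\<zeta> k)\<^sup>2) = 0"
    and fin: "\<And>z. finite {k\<in>I. (\<zeta> k)\<^sup>2 = z}"
    and ord: "\<And>z. zorder g z = int (card {k\<in>I. (\<zeta> k)\<^sup>2 = z})"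
  shows "lists_zeros (\<lambda>w. g (w\<^sup>2)) (I <+> I) (case_sum (\<lambda>k. \<zeta> k) (\<lambda>k. - \<zeta> k))"
  unfolding lists_zeros_def
proof (intro conjI ballI allI impI)
  fix i assume "i \<in> I <+> I"
  then show "g ((case_sum (\<lambda>k. \<zeta> k) (\<lambda>k. - \<zeta> k) i)\<^sup>2) = 0" by (auto simp: zero)
next
  fix w assume gw: "g (w\<^sup>2) = 0"
  have w: "w \<noteq> 0" using gw g0 by auto
  define P where "P = {k\<in>I. \<zeta> k = w}"
  define Q where "Q = {k\<in>I. - \<zeta> k = w}"
  have set: "{i \<in> I <+> I. case_sum (\<lambda>k. \<zeta> k) (\<lambda>k. - \<zeta> k) i = w} = P <+> Q"
    by (auto simp: P_def Q_def)
  have PQ: "P \<union> Q = {k\<in>I. (\<zeta> k)\<^sup>2 = w\<^sup>2}"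
    by (auto simp: P_def Q_def power2_eq_iff)
  have "finite (P \<union> Q)" unfolding PQ by (rule fin)
  then have finPQ: "finite P" "finite Q" by auto
  have disj: "P \<inter> Q = {}" using w by (auto simp: P_def Q_def)
  show "finite {i \<in> I <+> I. case_sum (\<lambda>k. \<zeta> k) (\<lambda>k. - \<zeta> k) i = w}"
    unfolding set using finPQ by simp
  have "card (P <+> Q) = card (P \<union> Q)"
    using finPQ disj by (simp add: card_Plus card_Un_disjoint)
  then show "int (card {i \<in> I <+> I. case_sum (\<lambda>k. \<zeta> k) (\<lambda>k. - \<zeta> k) i = w}) = zorder (\<lambda>w. g (w\<^sup>2)) w"
    unfolding set zorder_compose_square[OF holo g0 w] ord PQ by simp
qed

text \<open>
  Since the moduli of the \<open>\<mu> k\<close> decrease, all \<open>\<mu> k\<close> vanish from some index on or none does;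
  \<open>N\<close> is the number of those that do not vanish.
\<close>

lemma even_product_zeros:
  fixes \<mu> :: "nat \<Rightarrow> complex" and g :: "complex \<Rightarrow> complex"
  assumes dec: "\<And>k. cmod (\<mu> (Suc k)) \<le> cmod (\<mu> k)" and summable: "summable (\<lambda>k. cmod (\<mu> k))"
    and lim: "\<And>z. (\<lambda>N. \<Prod>k<N. 1 - z * \<mu> k) \<longlonglongrightarrow> g z"
  shows "g holomorphic_on UNIV \<and>
    (\<exists>(N :: enat) (\<zeta> :: nat \<Rightarrow> complex).
       lists_zeros (\<lambda>w. g (w\<^sup>2))
         ({k. 1 \<le> k \<and> enat k \<le> N} <+> {k. 1 \<le> k \<and> enat k \<le> N})
         (case_sum (\<lambda>k. \<zeta> k) (\<lambda>k. - \<zeta> k)) \<and>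
       (\<forall>w. case N of
              enat n \<Rightarrow> g (w\<^sup>2) = (\<Prod>k=1..n. 1 - w\<^sup>2 / (\<zeta> k)\<^sup>2)
            | \<infinity> \<Rightarrow> (\<lambda>j. 1 - w\<^sup>2 / (\<zeta> (j + 1))\<^sup>2) has_prod g (w\<^sup>2)))"
proof -
  have "(\<lambda>N. \<Prod>k<N. 1 - 0 * \<mu> k) \<longlonglongrightarrow> g 0" by (rule lim)
  then have g0: "g 0 \<noteq> 0" using LIMSEQ_unique[of "\<lambda>_. 1" 1 "g 0"] by auto
  \<comment> \<open>The \<open>\<zeta>\<close> are numbered from 1, the \<open>\<mu>\<close> from 0.\<close>
  define \<zeta> where "\<zeta> = (\<lambda>k. 1 / csqrt (\<mu> (k - 1)))"
  have \<zeta>: "(\<zeta> (Suc j))\<^sup>2 = 1 / \<mu> j" for j by (simp add: \<zeta>_def power_divide)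
  have lists: "lists_zeros (\<lambda>w. g (w\<^sup>2)) (I <+> I) (case_sum (\<lambda>k. \<zeta> k) (\<lambda>k. - \<zeta> k))"
    if holo: "g holomorphic_on UNIV" and I: "I = Suc ` J" and nz: "\<And>j. j \<in> J \<Longrightarrow> \<mu> j \<noteq> 0"
      and zero: "\<And>j. j \<in> J \<Longrightarrow> g (1 / \<mu> j) = 0"
      and fin: "\<And>z. finite {j\<in>J. z * \<mu> j = 1}"
      and ord: "\<And>z. zorder g z = int (card {j\<in>J. z * \<mu> j = 1})" for I J
  proof -
    have set: "{k\<in>I. (\<zeta> k)\<^sup>2 = z} = Suc ` {j\<in>J. z * \<mu> j = 1}" for z
    proof -
      have "1 / \<mu> j = z \<longleftrightarrow> z * \<mu> j = 1" if "j \<in> J" for j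
        using nz[OF that] by (auto simp: field_simps)
      then have "{j\<in>J. 1 / \<mu> j = z} = {j\<in>J. z * \<mu> j = 1}" by blast
      moreover have "{k\<in>I. (\<zeta> k)\<^sup>2 = z} = Suc ` {j\<in>J. 1 / \<mu> j = z}" by (auto simp: I \<zeta>)
      ultimately show ?thesis by simp
    qed
    show ?thesis
    proof (rule lists_zeros_square[OF holo g0])
      show "g ((\<zeta> k)\<^sup>2) = 0" if "k \<in> I" for k using that zero by (auto simp: I \<zeta>)
      show "finite {k\<in>I. (\<zeta> k)\<^sup>2 = z}" for z unfolding set using fin by simp
      show "zorder g z = int (card {k\<in>I. (\<zeta> k)\<^sup>2 = z})" for z
        unfolding set ord by (simp add: card_image)
    qed
  qed
  show ?thesis
  proof (cases "\<exists>k. \<mu> k = 0")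
    case False
    then have nz: "\<mu> k \<noteq> 0" for k by simp
    note W = infinite_product_zeros[OF nz summable lim]
    have I: "{k. 1 \<le> k \<and> enat k \<le> \<infinity>} = Suc ` UNIV"
      by (auto simp: image_iff gr0_conv_Suc Suc_le_eq)
    have "lists_zeros (\<lambda>w. g (w\<^sup>2))
        ({k. 1 \<le> k \<and> enat k \<le> \<infinity>} <+> {k. 1 \<le> k \<and> enat k \<le> \<infinity>})
        (case_sum (\<lambda>k. \<zeta> k) (\<lambda>k. - \<zeta> k))"
    proof (rule lists[OF W(1) I nz])
      show "g (1 / \<mu> j) = 0" for j
        using nz unfolding W(3) by (auto intro!: exI[of _ j])
      show "finite {j\<in>UNIV. z * \<mu> j = 1}" for z using W(4)[of z] by simp
      show "zorder g z = int (card {j\<in>UNIV. z * \<mu> j = 1})" for z using W(5)[of z] by simp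
    qed
    moreover have "(\<lambda>j. 1 - w\<^sup>2 / (\<zeta> (j + 1))\<^sup>2) has_prod g (w\<^sup>2)" for w
      using W(2)[of "w\<^sup>2"] by (simp add: \<zeta>)
    ultimately show ?thesis using W(1) by (intro conjI exI[of _ \<infinity>] exI[of _ \<zeta>]) auto
  next
    case True
    define n where "n = (LEAST k. \<mu> k = 0)"
    have n: "\<mu> n = 0" unfolding n_def using True by (rule LeastI_ex)
    have nz: "\<mu> j \<noteq> 0" if "j \<in> {..<n}" for j using that not_less_Least unfolding n_def by auto
    have zero: "\<mu> (n + j) = 0" for j
    proof (induction j)
      case (Suc j)
      then show ?case using dec[of "n + j"] by simp
    qed (simp add: n)
    have g: "g = (\<lambda>z. \<Prod>k<n. 1 - z * \<mu> k)"
    proof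
      fix z
      have "\<forall>\<^sub>F N in sequentially. (\<Prod>k<N. 1 - z * \<mu> k) = (\<Prod>k<n. 1 - z * \<mu> k)"
        using eventually_ge_at_top[of n]
      proof eventually_elim
        case (elim N)
        have "\<mu> k = 0" if "k \<ge> n" for k using zero[of "k - n"] that by simp
        then show ?case using elim by (intro prod.mono_neutral_right) auto
      qed
      then have "(\<lambda>N. \<Prod>k<N. 1 - z * \<mu> k) \<longlonglongrightarrow> (\<Prod>k<n. 1 - z * \<mu> k)"
        by (rule tendsto_eventually)
      with lim show "g z = (\<Prod>k<n. 1 - z * \<mu> k)" by (rule LIMSEQ_unique)
    qed
    have holo: "g holomorphic_on UNIV" unfolding g by (intro holomorphic_intros)
    have I: "{k. 1 \<le> k \<and> enat k \<le> enat n} = Suc ` {..<n}"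
      by (auto simp: image_iff Suc_le_eq gr0_conv_Suc)
    have "lists_zeros (\<lambda>w. g (w\<^sup>2))
        ({k. 1 \<le> k \<and> enat k \<le> enat n} <+> {k. 1 \<le> k \<and> enat k \<le> enat n})
        (case_sum (\<lambda>k. \<zeta> k) (\<lambda>k. - \<zeta> k))"
    proof (rule lists[OF holo I nz])
      show "g (1 / \<mu> j) = 0" if "j \<in> {..<n}" for j
        unfolding g using that nz by (auto simp: prod_zero_iff)
      show "zorder g z = int (card {j\<in>{..<n}. z * \<mu> j = 1})" for z
        unfolding g by (rule finite_product_zorder) (use nz in auto)
    qed auto
    moreover have "g (w\<^sup>2) = (\<Prod>k=1..n. 1 - w\<^sup>2 / (\<zeta> k)\<^sup>2)" for w
      unfolding g by (simp add: \<zeta> prod.atLeast1_atMost_eq)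
    ultimately show ?thesis using holo by (intro conjI exI[of _ "enat n"] exI[of _ \<zeta>]) auto
  qed
qed

section \<open>Factorisation of the characteristic function\<close>

context summable_neighbours
begin

lemma sum_nb_le_tail: "(\<Sum>k\<in>{K..<n}. cmod (nb (l + k))) \<le> tail (l + K)"
proof (cases "K \<le> n")
  case True
  then have "(\<Sum>k\<in>{K..<n}. cmod (nb (l + k))) + tail (l + n) = tail (l + K)"
  proof (induction n rule: dec_induct)
    case (step n)
    then show ?case using tail_Suc[of "l + n"] by simp
  qed simp
  then show ?thesis using tail_nonneg[of "l + n"] by linarith
qed (simp add: tail_nonneg)

text \<open>
  The characteristic series is the product of the factors \<open>1 - z * \<mu> k\<close>. The factorisations of its
  continuants satisfy the hypotheses of \<open>product_limit\<close> uniformly in \<open>n\<close>.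
\<close>

lemma char_series_product:
  obtains \<mu> where "\<And>k. cmod (\<mu> (Suc k)) \<le> cmod (\<mu> k)" "summable (\<lambda>k. cmod (\<mu> k))"
    "\<And>z. (\<lambda>N. \<Prod>k<N. 1 - z * \<mu> k) \<longlonglongrightarrow> char_series z l"
proof -
  define a where "a = (\<lambda>k. nb (l + k))"
  define c where "c = (\<lambda>K. \<Sum>k<K. sqrt (cmod (a k)))"
  have a_le: "(\<Sum>k\<in>{K..<n}. cmod (a k)) \<le> tail (l + K)" for K n
    unfolding a_def by (rule sum_nb_le_tail)
  have a_le0: "(\<Sum>k<n. cmod (a k)) \<le> tail l" for n
    using a_le[of 0 n] by (simp add: atLeast0LessThan)
  define good where "good = (\<lambda>n (m :: nat \<Rightarrow> complex). (\<forall>k. cmod (m (Suc k)) \<le> cmod (m k)) \<and>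
      (\<exists>L. \<forall>N\<ge>L. \<forall>z. (\<Prod>k<N. 1 - z * m k) = poly (continuant a n) z) \<and>
      (\<forall>N. (\<Sum>k<N. cmod (m k)) \<le> tail l) \<and>
      (\<forall>\<delta>\<ge>0. \<forall>K N. (\<Sum>k<N. if cmod (m k) \<le> \<delta>\<^sup>2 then cmod (m k) else 0)
         \<le> \<delta> * c K + sqrt (tail l) * sqrt (tail (l + K))))"
  have "\<exists>m. good n m" for n
  proof -
    obtain M where M: "\<And>z. poly (continuant a n) z = (\<Prod>\<mu>\<in>#M. 1 - z * \<mu>)"
      "(\<Sum>\<mu>\<in>#M. cmod \<mu>) \<le> (\<Sum>k<n. cmod (a k))"
      "\<And>\<delta> K. \<delta> \<ge> 0 \<Longrightarrow> (\<Sum>\<mu>\<in>#M. if cmod \<mu> \<le> \<delta>\<^sup>2 then cmod \<mu> else 0)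
         \<le> \<delta> * (\<Sum>k<K. sqrt (cmod (a k)))
           + sqrt (\<Sum>k<n. cmod (a k)) * sqrt (\<Sum>k\<in>{K..<n}. cmod (a k))"
      by (rule continuant_factorization[of a n]) (rule that)
    show ?thesis
    proof (rule sorted_enumeration[of M])
      fix m :: "nat \<Rightarrow> complex"
      assume m: "\<And>k. cmod (m (Suc k)) \<le> cmod (m k)"
        "\<exists>L. \<forall>N\<ge>L. \<forall>z. (\<Prod>k<N. 1 - z * m k) = (\<Prod>\<mu>\<in>#M. 1 - z * \<mu>)"
        "\<And>(h :: complex \<Rightarrow> real) N. (\<And>\<mu>. h \<mu> \<ge> 0) \<Longrightarrow> h 0 = 0 \<Longrightarrow>
           (\<Sum>k<N. h (m k)) \<le> (\<Sum>\<mu>\<in>#M. h \<mu>)"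
      show ?thesis
        unfolding good_def
      proof (intro exI[of _ m] conjI allI impI)
        show "cmod (m (Suc k)) \<le> cmod (m k)" for k by (rule m(1))
        show "\<exists>L. \<forall>N\<ge>L. \<forall>z. (\<Prod>k<N. 1 - z * m k) = poly (continuant a n) z"
          unfolding M(1) by (rule m(2))
        show "(\<Sum>k<N. cmod (m k)) \<le> tail l" for N
          using m(3)[of cmod N] M(2) a_le0[of n] by simp
        fix \<delta> :: real and K N
        assume \<delta>: "0 \<le> \<delta>"
        have "(\<Sum>k<N. if cmod (m k) \<le> \<delta>\<^sup>2 then cmod (m k) else 0)
            \<le> (\<Sum>\<mu>\<in>#M. if cmod \<mu> \<le> \<delta>\<^sup>2 then cmod \<mu> else 0)"
          by (rule m(3)) auto
        also have "\<dots> \<le> \<delta> * c K + sqrt (\<Sum>k<n. cmod (a k)) * sqrt (\<Sum>k\<in>{K..<n}. cmod (a k))"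
          unfolding c_def by (rule M(3)[OF \<delta>])
        also have "\<dots> \<le> \<delta> * c K + sqrt (tail l) * sqrt (tail (l + K))"
          by (intro add_left_mono mult_mono real_sqrt_le_mono a_le a_le0 real_sqrt_ge_zero
              tail_nonneg sum_nonneg) auto
        finally show "(\<Sum>k<N. if cmod (m k) \<le> \<delta>\<^sup>2 then cmod (m k) else 0)
            \<le> \<delta> * c K + sqrt (tail l) * sqrt (tail (l + K))" .
      qed
    qed
  qed
  then have "\<forall>n. \<exists>m. good n m" by blast
  from choice[OF this] obtain m where m: "\<And>n. good n (m n)" by blast
  have dec: "cmod (m n (Suc k)) \<le> cmod (m n k)" for n k
    using m[of n] unfolding good_def by blast
  have prod: "\<exists>L. \<forall>N\<ge>L. \<forall>z. (\<Prod>k<N. 1 - z * m n k) = poly (continuant a n) z" for n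
    using m[of n] unfolding good_def by blast
  have tot: "(\<Sum>k<N. cmod (m n k)) \<le> tail l" for n N
    using m[of n] unfolding good_def by blast
  have small: "(\<Sum>k<N. if cmod (m n k) \<le> \<delta>\<^sup>2 then cmod (m n k) else 0)
      \<le> \<delta> * c K + sqrt (tail l) * sqrt (tail (l + K))" if "0 \<le> \<delta>" for n \<delta> K N
    using m[of n] that unfolding good_def by blast
  have lim: "(\<lambda>n. poly (continuant a n) z) \<longlonglongrightarrow> char_series z l" for z
    unfolding a_def by (rule continuant_tendsto_char_series)
  have uniform: "\<exists>\<epsilon>>0. \<forall>n N. (\<Sum>k<N. if cmod (m n k) \<le> \<epsilon> then cmod (m n k) else 0) \<le> \<eta>"
    if \<eta>: "\<eta> > 0" for \<eta>
  proof -
    have "(\<lambda>K. tail (K + l)) \<longlonglongrightarrow> 0" by (rule LIMSEQ_ignore_initial_segment[OF tail_tendsto_0])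
    then have "(\<lambda>K. tail (l + K)) \<longlonglongrightarrow> 0" by (simp add: add.commute)
    then have "(\<lambda>K. sqrt (tail l) * sqrt (tail (l + K))) \<longlonglongrightarrow> sqrt (tail l) * sqrt 0"
      by (intro tendsto_intros)
    then have "\<forall>\<^sub>F K in sequentially. sqrt (tail l) * sqrt (tail (l + K)) < \<eta> / 2"
      using \<eta> by (intro order_tendstoD(2)) auto
    then obtain K where K: "sqrt (tail l) * sqrt (tail (l + K)) < \<eta> / 2"
      by (auto simp: eventually_sequentially)
    have c: "c K \<ge> 0" unfolding c_def by (intro sum_nonneg) simp
    \<comment> \<open>Adding 1 to \<open>c K\<close> avoids a division by 0.\<close>
    define \<delta> where "\<delta> = \<eta> / (2 * (c K + 1))"
    have \<delta>: "\<delta> > 0" using \<eta> c by (simp add: \<delta>_def)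
    have "\<delta> * c K \<le> \<delta> * (c K + 1)" using \<delta> by (intro mult_left_mono) auto
    also have "\<dots> = \<eta> / 2" using c by (simp add: \<delta>_def field_simps)
    finally have \<delta>c: "\<delta> * c K \<le> \<eta> / 2" .
    have "(\<Sum>k<N. if cmod (m n k) \<le> \<delta>\<^sup>2 then cmod (m n k) else 0) \<le> \<eta>" for n N
      using small[of \<delta> n N K] \<delta> \<delta>c K by linarith
    with \<delta> show ?thesis by (intro exI[of _ "\<delta>\<^sup>2"]) simp
  qed
  show ?thesis
    by (rule product_limit[of m "tail l" "\<lambda>n. poly (continuant a n)" "\<lambda>z. char_series z l",
          OF dec tot uniform prod lim]) (assumption | rule that)+
qed

end

theorem theorem15:
  fixes x :: "nat \<Rightarrow> complex" and f :: "complex \<Rightarrow> complex"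
  defines "f \<equiv> (\<lambda>w. frakF (\<lambda>k. w * x k))"
  assumes nonzero: "\<And>k. k \<ge> 1 \<Longrightarrow> x k \<noteq> 0"
    and domain: "x \<in> frakF_domain"
  shows "f holomorphic_on UNIV \<and> (\<forall>w. f (- w) = f w) \<and>
    (\<exists>(N :: enat) (\<zeta> :: nat \<Rightarrow> complex).
       lists_zeros f
         ({k. 1 \<le> k \<and> enat k \<le> N} <+> {k. 1 \<le> k \<and> enat k \<le> N})
         (case_sum (\<lambda>k. \<zeta> k) (\<lambda>k. - \<zeta> k)) \<and>
       (\<forall>w. case N of
              enat n \<Rightarrow> f w = (\<Prod>k=1..n. 1 - w\<^sup>2 / (\<zeta> k)\<^sup>2)
            | \<infinity> \<Rightarrow> (\<lambda>j. 1 - w\<^sup>2 / (\<zeta> (j + 1))\<^sup>2) has_prod f w))"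
proof -
  interpret summable_neighbours x by unfold_locales (rule domain)
  define g where "g = (\<lambda>z. char_series z 1)"
  have f: "f = (\<lambda>w. g (w\<^sup>2))" by (simp add: f_def g_def frakF_eq_char_series)
  obtain \<mu> where \<mu>: "\<And>k. cmod (\<mu> (Suc k)) \<le> cmod (\<mu> k)" "summable (\<lambda>k. cmod (\<mu> k))"
    "\<And>z. (\<lambda>N. \<Prod>k<N. 1 - z * \<mu> k) \<longlonglongrightarrow> char_series z 1"
    by (rule char_series_product[of 1]) (rule that)
  have "(\<lambda>N. \<Prod>k<N. 1 - z * \<mu> k) \<longlonglongrightarrow> g z" for z
    unfolding g_def by (rule \<mu>(3))
  note main = even_product_zeros[OF \<mu>(1,2) this]
  have "(g \<circ> (\<lambda>w. w\<^sup>2)) holomorphic_on UNIV"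
    by (rule holomorphic_on_compose)
      (use main in \<open>auto intro!: holomorphic_intros elim: holomorphic_on_subset\<close>)
  then have "f holomorphic_on UNIV" by (simp add: f o_def)
  moreover have "f (- w) = f w" for w by (simp add: f)
  ultimately show ?thesis using main unfolding f by blast
qed

end
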